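(* For every $\varepsilon>0$ and every countable ordinal $\delta$, the scattered space $\omega^{\delta+1}+1$ (with the order topology) is homeomorphic to the attractor of an iterated function system consisting of two contractions $\{\varphi,\varphi_{\delta+1}\}$ in the unit interval $I=[0,1]$ such that $\max(\operatorname{Lip}(\varphi),\operatorname{Lip}(\varphi_{\delta+1}))<\varepsilon$.
   Context: The ordinal $\omega^{\delta+1}+1$ is identified with the set of ordinals less than it (ordinal exponentiation), with the order topology. $I$ carries the usual distance $d$. A contraction in $I$ is a map $f:I\to I$ for which there is $\alpha\in(0,1)$ with $d(f(x),f(y))\le\alpha\, d(x,y)$ for all $x,y\in I$; $\operatorname{Lip}(f)$ denotes its Lipschitz constant (the least such constant). The attractor of the iterated function system $\{\varphi,\varphi_{\delta+1}\}$ is the unique nonempty compact set $K\subset I$ with $K=\varphi(K)\cup\varphi_{\delta+1}(K)$. *)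

theory Defs
  imports "HOL-Analysis.Analysis"
begin

text \<open>
  An ordinal is represented by a well-order relation of that order type
  (predicate \<^term>\<open>Well_order\<close>); its set of smaller ordinals is then the field of the relation.
\<close>

definition ord_succ :: "'a rel \<Rightarrow> 'a option rel" where
  "ord_succ r = {(Some x, Some y) | x y. (x, y) \<in> r}
     \<union> {(Some x, None) | x. x \<in> Field r} \<union> {(None, None)}"

text \<open>
  Ordinal exponentiation with base \<open>\<omega>\<close>, in its usual order-theoretic form (Cantor normal form):
  the elements below \<open>\<omega>\<close> to the power \<open>s\<close> are the finitely supported functions
  from the field of \<open>s\<close> to the natural numbers, compared at the \<open>s\<close>-largest argument
  where they differ. Functions are required to vanish outside the field of \<open>s\<close>, so that equality
  of functions is equality on the field.
\<close>

definition fin_supp_funs :: "'a rel \<Rightarrow> ('a \<Rightarrow> nat) set" where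
  "fin_supp_funs s = {f. finite {x. f x \<noteq> 0} \<and> {x. f x \<noteq> 0} \<subseteq> Field s}"

definition omega_power :: "'a rel \<Rightarrow> ('a \<Rightarrow> nat) rel" where
  "omega_power s = {(f, g). f \<in> fin_supp_funs s \<and> g \<in> fin_supp_funs s \<and>
     (f = g \<or> (\<exists>z\<in>Field s. f z < g z \<and> (\<forall>y\<in>aboveS s z. f y = g y)))}"

text \<open>
  The field itself is included as a generator so that a one-point order,
  which has only empty open rays, still gets the full underlying set.
\<close>

definition ord_topology :: "'a rel \<Rightarrow> 'a topology" where
  "ord_topology r = topology_generated_by
     ({Field r} \<union> {underS r a | a. a \<in> Field r} \<union> {aboveS r a | a. a \<in> Field r})"

definition contraction_in :: "'a::metric_space set \<Rightarrow> ('a \<Rightarrow> 'a) \<Rightarrow> bool" where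
  "contraction_in S f \<longleftrightarrow> f ` S \<subseteq> S \<and> (\<exists>\<alpha>. 0 < \<alpha> \<and> \<alpha> < 1 \<and> \<alpha>-lipschitz_on S f)"

definition Lip :: "'a::metric_space set \<Rightarrow> ('a \<Rightarrow> 'b::metric_space) \<Rightarrow> real" where
  "Lip S f = Inf {C. C-lipschitz_on S f}"

definition invariant_compact :: "'a::metric_space set \<Rightarrow> ('a \<Rightarrow> 'a) set \<Rightarrow> 'a set \<Rightarrow> bool" where
  "invariant_compact S F K \<longleftrightarrow>
     K \<subseteq> S \<and> K \<noteq> {} \<and> compact K \<and> K = (\<Union>f\<in>F. f ` K)"

definition is_attractor :: "'a::metric_space set \<Rightarrow> ('a \<Rightarrow> 'a) set \<Rightarrow> 'a set \<Rightarrow> bool" where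
  "is_attractor S F K \<longleftrightarrow>
     invariant_compact S F K \<and> (\<forall>L. invariant_compact S F L \<longrightarrow> L = K)"

end

theory Submission
  imports Defs
begin

text \<open>
  Write \<open>s\<close> for \<open>ord_succ \<delta>\<close>, the set of exponents, with greatest element \<open>\<tau>\<close>. The ordinal
  \<open>omega_power s\<close> with an endpoint added is realized as a tree of points in the unit interval. Let \<open>e\<close>
  enumerate \<open>s\<close>, each exponent infinitely often. A node with exponent \<open>b\<close> has one child for every
  number \<open>n\<close> with \<open>e n\<close> below \<open>b\<close>, the child gets the exponent \<open>e n\<close>, and the children converge to the
  node. Since exponents descend, branches are finite; nodes are lists of numbers, \<open>paths b\<close> is the
  tree below a node with exponent \<open>b\<close>, and \<open>code t\<close> places the lists on the line, the child \<open>n\<close> at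
  distance \<open>t ^ (n + 1)\<close> and in a copy shrunk by \<open>t ^ (n + 2)\<close>. The attractor has a root whose children
  all have the exponent \<open>\<tau>\<close>, one for each number.

  One index set for all exponents makes the system work. The subtree \<open>paths b\<close> sits in \<open>paths \<tau>\<close> at
  the same scale for every \<open>b\<close>, and dropping the blocks with too large an exponent is a retraction
  whose Lipschitz constant \<open>2\<close> does not depend on \<open>b\<close>. The map \<open>x \<mapsto> t * x\<close> shifts the first entry of a
  list and so yields all children of the root but the first. The second map has to cover the first
  child, a copy of \<open>paths \<tau>\<close>: it retracts the \<open>n\<close>-th child of the root onto the \<open>n\<close>-th block of that
  copy, if \<open>e n\<close> is below \<open>\<tau>\<close>, and contracts it to a point otherwise. Both constants are at most \<open>t\<close>
  (\<open>attractor_system\<close>), and \<open>t\<close> is arbitrarily small.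

  It remains to identify the attractor with the ordinal. For compact sets of reals it suffices to
  compare orders (\<open>ord_topology_homeomorphic_compact\<close>). The order reversed by \<open>code t\<close> is the
  lexicographic one in which a list comes after its extensions. So the tree below a node with positive
  exponent \<open>b\<close> is, without its end, the sum of its blocks in the order of their indices. A block with
  exponent \<open>0\<close> is a point; a block with exponent \<open>c > 0\<close> has, by induction, the type of \<open>\<omega>\<close> to the
  power \<open>c\<close> followed by an end. Small summands in front of a larger one are absorbed, and each
  exponent below \<open>b\<close> returns infinitely often, so the sum is \<open>\<omega>\<close> to the power \<open>b\<close>. Ordinal
  addition is avoided: two well-orders are compared by mapping the proper initial segments of one into those of the other
  (\<open>ordLeq_if_segments_embed\<close>), in one direction through the leading coefficient of a function
  (\<open>funs_segment_embeds\<close>), in the other through the running maximum of the exponents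
  (\<open>path_fun_increasing\<close>).
\<close>

section \<open>Contractions, attractors and Lipschitz extension\<close>

text \<open>
  The infimum of the cones \<open>\<lambda>x. g k + L * dist x k\<close> over \<open>k \<in> K\<close> is the largest
  \<open>L\<close>-Lipschitz extension of \<open>g\<close>; cutting it off at \<open>1\<close> keeps the constant.
\<close>

lemma lipschitz_extension_unit_interval:
  fixes g :: "'a::metric_space \<Rightarrow> real"
  assumes lip: "L-lipschitz_on K g" and K: "K \<noteq> {}" and range: "g ` K \<subseteq> {0..1}"
  obtains G where "L-lipschitz_on UNIV G" "\<And>x. x \<in> K \<Longrightarrow> G x = g x" "range G \<subseteq> {0..1}"
proof -
  have L: "0 \<le> L"
    using lip by (rule lipschitz_on_nonneg)
  define H where "H x = (INF k\<in>K. g k + L * dist x k)" for x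
  have lower: "0 \<le> g k + L * dist x k" if "k \<in> K" for k x
    using that range L by (intro add_nonneg_nonneg mult_nonneg_nonneg) auto
  have bdd: "bdd_below ((\<lambda>k. g k + L * dist x k) ` K)" for x
    using lower by (intro bdd_belowI[of _ 0]) auto
  have step: "H x \<le> H y + L * dist x y" for x y
  proof -
    have "H x - L * dist x y \<le> g k + L * dist y k" if k: "k \<in> K" for k
    proof -
      have "H x \<le> g k + L * dist x k"
        unfolding H_def by (rule cINF_lower[OF bdd k])
      moreover have "L * dist x k \<le> L * (dist x y + dist y k)"
        using L by (intro mult_left_mono dist_triangle)
      ultimately show ?thesis
        by (simp add: algebra_simps)
    qed
    then have "H x - L * dist x y \<le> H y"
      unfolding H_def[of y] by (rule cINF_greatest[OF K])
    then show ?thesis by simp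
  qed
  have Hg: "H x = g x" if x: "x \<in> K" for x
  proof (rule antisym)
    show "H x \<le> g x"
      unfolding H_def using cINF_lower[OF bdd x, of x] by simp
    show "g x \<le> H x"
      unfolding H_def
    proof (rule cINF_greatest[OF K])
      fix k assume "k \<in> K"
      then have "dist (g x) (g k) \<le> L * dist x k"
        using lip x by (intro lipschitz_onD)
      then show "g x \<le> g k + L * dist x k"
        by (simp add: dist_real_def)
    qed
  qed
  define G where "G x = min 1 (H x)" for x
  have "0 \<le> H x" for x
    unfolding H_def using K lower by (rule cINF_greatest)
  then have "range G \<subseteq> {0..1}"
    by (auto simp: G_def)
  moreover have "G x = g x" if "x \<in> K" for x
    using Hg[OF that] range that by (auto simp: G_def)
  moreover have "L-lipschitz_on UNIV G"
  proof (rule lipschitz_onI[OF _ L])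
    fix x y
    show "dist (G x) (G y) \<le> L * dist x y"
      using step[of x y] step[of y x] mult_nonneg_nonneg[OF L zero_le_dist[of x y]]
      by (auto simp: G_def dist_real_def dist_commute[of y x] min_def abs_le_iff)
  qed
  ultimately show thesis
    using that by blast
qed

text \<open>
  A point of \<open>A\<close> farthest from \<open>B\<close> is the image of a point of \<open>A\<close> under a contraction that also
  maps \<open>B\<close> into \<open>B\<close>; so the largest distance \<open>D\<close> from \<open>B\<close> satisfies \<open>D \<le> \<alpha> * D\<close>.
\<close>

lemma invariant_compact_subset:
  assumes lip: "\<And>f. f \<in> F \<Longrightarrow> \<alpha>-lipschitz_on S f" and \<alpha>: "\<alpha> < 1"
    and A: "invariant_compact S F A" and B: "invariant_compact S F B"
  shows "A \<subseteq> B"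
proof -
  have A': "A \<subseteq> S" "A \<noteq> {}" "compact A" "A = (\<Union>f\<in>F. f ` A)"
    and B': "B \<subseteq> S" "B \<noteq> {}" "compact B" "B = (\<Union>f\<in>F. f ` B)"
    using A B by (auto simp: invariant_compact_def)
  have "continuous_on A (\<lambda>x. infdist x B)"
    by (intro continuous_on_infdist continuous_on_id)
  \<comment> \<open>\<open>a\<close> is a point of \<open>A\<close> farthest from \<open>B\<close>.\<close>
  then obtain a where a: "a \<in> A" "\<And>x. x \<in> A \<Longrightarrow> infdist x B \<le> infdist a B"
    using continuous_attains_sup[OF A'(3,2)] by blast
  obtain f a' where f: "f \<in> F" "a' \<in> A" "a = f a'"
    using a(1) A'(4) by blast
  have "continuous_on B (\<lambda>x. dist a' x)"
    by (intro continuous_intros)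
  then obtain b where b: "b \<in> B" "\<And>y. y \<in> B \<Longrightarrow> dist a' b \<le> dist a' y"
    using continuous_attains_inf[OF B'(3,2)] by blast
  then have b': "dist a' b \<le> infdist a' B"
    using B'(2) by (simp add: infdist_notempty cINF_greatest)
  have \<alpha>0: "0 \<le> \<alpha>"
    using lip[OF f(1)] by (rule lipschitz_on_nonneg)
  have "f b \<in> B"
    using B'(4) b(1) f(1) by blast
  then have "infdist a B \<le> dist (f a') (f b)"
    using f(3) by (simp add: infdist_le)
  also have "\<dots> \<le> \<alpha> * dist a' b"
    using A'(1) B'(1) f(2) b(1) by (intro lipschitz_onD[OF lip[OF f(1)]]) auto
  also have "\<dots> \<le> \<alpha> * infdist a B"
    using b' a(2)[OF f(2)] \<alpha>0 by (intro mult_left_mono) auto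
  finally have "infdist a B * (1 - \<alpha>) \<le> 0"
    by (simp add: algebra_simps)
  then have "infdist a B \<le> 0"
    using \<alpha> by (simp add: mult_le_0_iff)
  then have "infdist x B = 0" if "x \<in> A" for x
    using a(2)[OF that] infdist_nonneg[of x B] by linarith
  then show ?thesis
    using in_closed_iff_infdist_zero[OF compact_imp_closed[OF B'(3)] B'(2)] by blast
qed

lemma is_attractorI:
  assumes "\<And>f. f \<in> F \<Longrightarrow> \<alpha>-lipschitz_on S f" "\<alpha> < 1" "invariant_compact S F K"
  shows "is_attractor S F K"
  unfolding is_attractor_def
  using invariant_compact_subset[OF assms(1,2)] assms(3) by (meson subset_antisym)

lemma Lip_le:
  assumes "C-lipschitz_on S f"
  shows "Lip S f \<le> C"
  unfolding Lip_def
proof (rule cInf_lower)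
  show "bdd_below {C. C-lipschitz_on S f}"
    by (intro bdd_belowI[of _ 0]) (auto dest: lipschitz_on_nonneg)
qed (use assms in simp)

text \<open>
  A neighbourhood of \<open>c\<close> contains all but finitely many of the sets \<open>A n\<close>.
\<close>

lemma compact_shrinking_union:
  fixes A :: "nat \<Rightarrow> 'a::metric_space set"
  assumes A: "\<And>n. compact (A n)"
    and bound: "\<And>n x. x \<in> A n \<Longrightarrow> dist x c \<le> b n" and b: "b \<longlonglongrightarrow> 0"
  shows "compact (insert c (\<Union>n. A n))"
proof (rule compactI)
  fix \<C> assume op: "\<forall>B\<in>\<C>. open B" and cov: "insert c (\<Union>n. A n) \<subseteq> \<Union>\<C>"
  obtain U where U: "U \<in> \<C>" "c \<in> U"
    using cov by blast
  then obtain r where r: "r > 0" "ball c r \<subseteq> U"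
    using op open_contains_ball by metis
  obtain N where N: "\<And>n. n \<ge> N \<Longrightarrow> b n < r"
    using order_tendstoD(2)[OF b r(1)] by (auto simp: eventually_sequentially)
  have tail: "A n \<subseteq> U" if "n \<ge> N" for n
    using r(2) N[OF that] bound by (fastforce simp: dist_commute)
  have "compact (\<Union>n<N. A n)"
    using A by (intro compact_UN) auto
  moreover have "(\<Union>n<N. A n) \<subseteq> \<Union>\<C>"
    using cov by blast
  ultimately obtain \<D> where D: "\<D> \<subseteq> \<C>" "finite \<D>" "(\<Union>n<N. A n) \<subseteq> \<Union>\<D>"
    using op by (metis compactE)
  have "insert c (\<Union>n. A n) \<subseteq> \<Union>(insert U \<D>)"
  proof -
    have "A n \<subseteq> \<Union>(insert U \<D>)" for n
      using tail[of n] D(3) by (cases "n < N") auto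
    then show ?thesis using U(2) by blast
  qed
  then show "\<exists>C'\<subseteq>\<C>. finite C' \<and> insert c (\<Union>n. A n) \<subseteq> \<Union>C'"
    using D(1,2) U(1) by (intro exI[of _ "insert U \<D>"]) auto
qed

section \<open>The order topology of a well-order\<close>

text \<open>
  Two points are separated by the rays that end at a point between them, or, if they are adjacent,
  by the rays that end at the points themselves.
\<close>

lemma Hausdorff_space_ord_topology:
  assumes "Linear_order r"
  shows "Hausdorff_space (ord_topology r)"
  unfolding Hausdorff_space_def
proof (intro allI impI)
  have top: "topspace (ord_topology r) = Field r"
    by (auto simp: ord_topology_def underS_def aboveS_def Field_def)
  have under: "openin (ord_topology r) (underS r a)" and above: "openin (ord_topology r) (aboveS r a)"
    if "a \<in> Field r" for a
    using that by (auto simp: ord_topology_def intro!: topology_generated_by_Basis)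
  have tr: "trans r" and an: "antisym r"
    using assms by (auto simp: order_on_defs)
  have sep: "\<exists>U V. openin (ord_topology r) U \<and> openin (ord_topology r) V \<and> x \<in> U \<and> y \<in> V \<and> disjnt U V"
    if xy: "(x, y) \<in> r" "x \<noteq> y" for x y
  proof (cases "\<exists>z. z \<in> aboveS r x \<and> z \<in> underS r y")
    case True
    then obtain z where z: "z \<in> aboveS r x" "z \<in> underS r y" by blast
    then have "z \<in> Field r" by (auto simp: underS_def Field_def)
    moreover have "x \<in> underS r z" "y \<in> aboveS r z"
      using z by (auto simp: underS_def aboveS_def)
    moreover have "disjnt (underS r z) (aboveS r z)"
      using an by (auto simp: disjnt_def underS_def aboveS_def dest: antisymD)
    ultimately show ?thesis
      using under above by blast
  next
    case False
    have "x \<in> underS r y" "y \<in> aboveS r x" "x \<in> Field r" "y \<in> Field r"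
      using xy by (auto simp: underS_def aboveS_def Field_def)
    moreover have "disjnt (underS r y) (aboveS r x)"
      using False by (auto simp: disjnt_def)
    ultimately show ?thesis
      using under above by blast
  qed
  fix x y assume "x \<in> topspace (ord_topology r) \<and> y \<in> topspace (ord_topology r) \<and> x \<noteq> y"
  then have "x \<in> Field r" "y \<in> Field r" "x \<noteq> y"
    using top by auto
  then have "(x, y) \<in> r \<or> (y, x) \<in> r"
    using assms by (auto simp: order_on_defs total_on_def)
  then show "\<exists>U V. openin (ord_topology r) U \<and> openin (ord_topology r) V \<and> x \<in> U \<and> y \<in> V \<and> disjnt U V"
    using sep[of x y] sep[of y x] \<open>x \<noteq> y\<close> by (metis disjnt_sym)
qed

text \<open>
  Open rays pull back to open rays, so an order-reversing bijection from a compact set of reals is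
  continuous, and a continuous bijection from a compact space to a Hausdorff space is a
  homeomorphism.
\<close>

lemma ord_topology_homeomorphic_compact:
  fixes K :: "'b::linorder_topology set"
  assumes r: "Linear_order r" and K: "compact K" and g: "bij_betw g K (Field r)"
    and rev: "\<And>x y. x \<in> K \<Longrightarrow> y \<in> K \<Longrightarrow> y < x \<Longrightarrow> g x \<in> underS r (g y)"
  shows "ord_topology r homeomorphic_space top_of_set K"
proof -
  have an: "antisym r"
    using r by (auto simp: order_on_defs)
  have rev': "g x \<in> underS r (g y) \<longleftrightarrow> y < x" if "x \<in> K" "y \<in> K" for x y
  proof
    assume *: "g x \<in> underS r (g y)"
    show "y < x"
    proof (rule ccontr)
      assume "\<not> y < x"
      then have "x = y \<or> x < y" by auto
      then show False
        using * rev[OF that(2,1)] an by (auto simp: underS_def dest: antisymD)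
    qed
  qed (use rev that in blast)
  have top: "topspace (ord_topology r) = Field r"
    by (auto simp: ord_topology_def underS_def aboveS_def Field_def)
  have gK: "g ` K = Field r" and inj: "inj_on g K"
    using g by (auto simp: bij_betw_def)
  have "continuous_map (top_of_set K) (ord_topology r) g"
    unfolding ord_topology_def
  proof (rule continuous_on_generated_topo)
    fix U assume "U \<in> {Field r} \<union> {underS r a |a. a \<in> Field r} \<union> {aboveS r a |a. a \<in> Field r}"
    then consider "U = Field r" | a where "a \<in> Field r" "U = underS r a"
      | a where "a \<in> Field r" "U = aboveS r a" by blast
    then show "openin (top_of_set K) (g -` U \<inter> topspace (top_of_set K))"
    proof cases
      case 1
      then have "g -` U \<inter> topspace (top_of_set K) = topspace (top_of_set K)"
        using gK by auto
      then show ?thesis by (metis openin_topspace)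
    next
      case 2
      then obtain y where y: "y \<in> K" "a = g y"
        using gK by blast
      then have "g -` U \<inter> topspace (top_of_set K) = K \<inter> {y<..}"
        using 2 rev' by auto
      then show ?thesis by (simp add: openin_open_Int)
    next
      case 3
      then obtain y where y: "y \<in> K" "a = g y"
        using gK by blast
      have "z \<in> aboveS r a \<longleftrightarrow> a \<in> underS r z" for z
        by (auto simp: aboveS_def underS_def)
      then have "g -` U \<inter> topspace (top_of_set K) = K \<inter> {..<y}"
        using 3 y rev' by auto
      then show ?thesis by (simp add: openin_open_Int)
    qed
  next
    show "g ` topspace (top_of_set K)
       \<subseteq> \<Union> ({Field r} \<union> {underS r a |a. a \<in> Field r} \<union> {aboveS r a |a. a \<in> Field r})"
      using gK by auto
  qed
  moreover have "compact_space (top_of_set K)"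
    using K by (simp add: compact_space_subtopology)
  ultimately have "homeomorphic_map (top_of_set K) (ord_topology r) g"
    using Hausdorff_space_ord_topology[OF r] top gK inj
    by (intro continuous_imp_homeomorphic_map) auto
  then show ?thesis
    using homeomorphic_map_imp_homeomorphic_space homeomorphic_space_sym by blast
qed

section \<open>Comparing well-orders by their initial segments\<close>

text \<open>
  If \<open>r'\<close> were shorter than \<open>r\<close>, it would be isomorphic to a proper initial segment of \<open>r\<close>,
  which by hypothesis maps strictly increasingly below some \<open>b\<close> in \<open>r'\<close>. But a strictly increasing
  map of a well-order into itself never moves a point down. Because the bound \<open>b\<close> may depend on the
  segment, no single increasing map has to be constructed. Well-foundedness of \<open>r\<close> is itself
  inherited from \<open>r'\<close> segment by segment.
\<close>

lemma ordLeq_if_segments_embed: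
  fixes r :: "'a rel" and r' :: "'b rel"
  assumes r: "Linear_order r" and r': "Well_order r'"
    and seg: "\<And>a. a \<in> Field r \<Longrightarrow> \<exists>b\<in>Field r'. \<exists>f. f ` underS r a \<subseteq> underS r' b \<and>
      monotone_on (underS r a) (\<lambda>x y. x \<in> underS r y) (\<lambda>x y. x \<in> underS r' y) f"
  shows "(r, r') \<in> ordLeq"
proof -
  have tr: "trans r" and an: "antisym r"
    using r by (auto simp: order_on_defs)
  have wf': "wf (r' - Id)"
    using r' by (simp add: well_order_on_def)
  have "wf (r - Id)"
  proof (rule wfI_min)
    fix x and Q :: "'a set" assume x: "x \<in> Q"
    show "\<exists>z\<in>Q. \<forall>y. (y, z) \<in> r - Id \<longrightarrow> y \<notin> Q"
    proof (cases "Q \<inter> underS r x = {}")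
      case True
      then show ?thesis using x by (auto simp: underS_def)
    next
      case False
      then have "x \<in> Field r" by (auto simp: underS_def Field_def)
      then obtain f where f: "monotone_on (underS r x) (\<lambda>x y. x \<in> underS r y) (\<lambda>x y. x \<in> underS r' y) f"
        using seg by blast
      obtain q where "f q \<in> f ` (Q \<inter> underS r x)"
        using False by blast
      then obtain w where w: "w \<in> f ` (Q \<inter> underS r x)"
        "\<And>v. (v, w) \<in> r' - Id \<Longrightarrow> v \<notin> f ` (Q \<inter> underS r x)"
        by (rule wfE_min[OF wf']) (rule that)
      then obtain z where z: "z \<in> Q" "z \<in> underS r x" "w = f z" by blast
      have "y \<notin> Q" if y: "(y, z) \<in> r - Id" for y
      proof
        assume "y \<in> Q"
        have "y \<in> underS r x"
          using y z(2) transD[OF tr, of y z x] antisymD[OF an, of y z] by (auto simp: underS_def)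
        moreover have "y \<in> underS r z"
          using y by (auto simp: underS_def)
        ultimately have "f y \<in> underS r' w"
          using monotone_onD[OF f _ z(2), of y] z(3) by simp
        then have "f y \<notin> f ` (Q \<inter> underS r x)"
          by (intro w(2)) (simp add: underS_def)
        then show False
          using \<open>y \<in> Q\<close> \<open>y \<in> underS r x\<close> by blast
      qed
      then show ?thesis using z(1) by blast
    qed
  qed
  then have wo: "Well_order r"
    using r by (simp add: well_order_on_def)
  show ?thesis
  proof (rule ccontr)
    assume "(r, r') \<notin> ordLeq"
    then have "(r', r) \<in> ordLess"
      using wo r' by (simp add: not_ordLeq_iff_ordLess)
    then obtain a where a: "a \<in> Field r" and iso: "(r', Restr r (underS r a)) \<in> ordIso"
      using ordLess_iff_ordIso_Restr[OF wo r'] by blast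
    obtain g where g: "iso r' (Restr r (underS r a)) g"
      using iso by (auto simp: ordIso_def)
    obtain b f where b: "b \<in> Field r'" and f: "f ` underS r a \<subseteq> underS r' b"
      "monotone_on (underS r a) (\<lambda>x y. x \<in> underS r y) (\<lambda>x y. x \<in> underS r' y) f"
      using seg[OF a] by blast
    have refl': "(x, x) \<in> r'" if "x \<in> Field r'" for x
      using r' that by (auto simp: order_on_defs refl_on_def)
    have ga: "g x \<in> underS r a" if "x \<in> Field r'" for x
      using iso_forward[OF refl'[OF that] g] by auto
    have inj: "inj_on g (Field r')"
      using g by (auto simp: iso_def bij_betw_def)
    define h where "h = f \<circ> g"
    have h_field: "h x \<in> underS r' b" if "x \<in> Field r'" for x
      using f(1) ga[OF that] by (auto simp: h_def)
    have h_mono: "h x \<in> underS r' (h y)" if xy: "x \<in> underS r' y" for x y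
    proof -
      have F: "x \<in> Field r'" "y \<in> Field r'"
        using xy by (auto simp: underS_def Field_def)
      have "(g x, g y) \<in> r"
        using iso_forward[OF _ g] xy by (auto simp: underS_def)
      moreover have "g x \<noteq> g y"
        using inj_onD[OF inj _ F] xy by (auto simp: underS_def)
      ultimately have "g x \<in> underS r (g y)"
        by (simp add: underS_def)
      then show ?thesis
        unfolding h_def comp_def using monotone_onD[OF f(2) ga[OF F(1)] ga[OF F(2)]] by blast
    qed
    \<comment> \<open>\<open>h\<close> is strictly increasing and moves \<open>b\<close> down, so it also moves down the least point
      that it moves down.\<close>
    have "b \<in> {x. h x \<in> underS r' x}"
      using h_field[OF b] by simp
    then obtain z where z: "z \<in> {x. h x \<in> underS r' x}"
      "\<And>y. (y, z) \<in> r' - Id \<Longrightarrow> y \<notin> {x. h x \<in> underS r' x}"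
      by (rule wfE_min[OF wf']) (rule that)
    then have "h (h z) \<in> underS r' (h z)" "(h z, z) \<in> r' - Id"
      using h_mono by (auto simp: underS_def)
    then show False
      using z(2) by blast
  qed
qed

section \<open>Ordinal powers of omega\<close>

definition omega_less :: "'b rel \<Rightarrow> ('b \<Rightarrow> nat) \<Rightarrow> ('b \<Rightarrow> nat) \<Rightarrow> bool" where
  "omega_less s f g \<longleftrightarrow> (\<exists>z\<in>Field s. f z < g z \<and> (\<forall>y\<in>aboveS s z. f y = g y))"

lemma omega_power_alt:
  "omega_power s = {(f, g). f \<in> fin_supp_funs s \<and> g \<in> fin_supp_funs s \<and> (f = g \<or> omega_less s f g)}"
  by (simp add: omega_power_def omega_less_def)

lemma omega_less_irrefl: "\<not> omega_less s f f"
  by (simp add: omega_less_def)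

lemma Field_omega_power: "Field (omega_power s) = fin_supp_funs s"
  by (auto simp: omega_power_alt Field_def)

lemma underS_omega_power:
  "f \<in> underS (omega_power s) g \<longleftrightarrow> f \<in> fin_supp_funs s \<and> g \<in> fin_supp_funs s \<and> omega_less s f g"
  using omega_less_irrefl by (auto simp: omega_power_alt underS_def)

lemma finite_has_greatest:
  assumes "Linear_order s" "finite C" "C \<noteq> {}" "C \<subseteq> Field s"
  shows "\<exists>z\<in>C. \<forall>y\<in>C. (y, z) \<in> s"
  using assms(2-4)
proof (induction C rule: finite_ne_induct)
  case (singleton x)
  then show ?case using assms(1) by (auto simp: order_on_defs refl_on_def)
next
  case (insert x C)
  then obtain z where z: "z \<in> C" "\<forall>y\<in>C. (y, z) \<in> s" by auto
  have tr: "trans s" and rf: "Refl s"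
    using assms(1) by (auto simp: order_on_defs)
  have "(x, z) \<in> s \<or> (z, x) \<in> s"
    using assms(1) insert.prems z(1) rf
    by (cases "x = z") (auto simp: order_on_defs total_on_def refl_on_def)
  then show ?case
  proof
    assume "(x, z) \<in> s"
    then show ?thesis using z by auto
  next
    assume "(z, x) \<in> s"
    then have "\<forall>y\<in>C. (y, x) \<in> s" "(x, x) \<in> s"
      using z tr rf insert.prems by (auto simp: refl_on_def dest: transD)
    then show ?thesis by auto
  qed
qed

lemma Linear_order_omega_power:
  assumes s: "Linear_order s"
  shows "Linear_order (omega_power s)"
proof -
  have tr: "trans s" and tot: "Total s" and an: "antisym s"
    using s by (auto simp: order_on_defs)
  have less_trans: "omega_less s f h" if fg: "omega_less s f g" and gh: "omega_less s g h" for f g h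
  proof -
    obtain z where z: "z \<in> Field s" "f z < g z" "\<And>y. y \<in> aboveS s z \<Longrightarrow> f y = g y"
      using fg unfolding omega_less_def by blast
    obtain w where w: "w \<in> Field s" "g w < h w" "\<And>y. y \<in> aboveS s w \<Longrightarrow> g y = h y"
      using gh unfolding omega_less_def by blast
    have above_trans: "c \<in> aboveS s a" if "b \<in> aboveS s a" "c \<in> aboveS s b" for a b c
      using that tr an by (auto simp: aboveS_def dest: transD antisymD)
    consider "z = w" | "w \<in> aboveS s z" | "z \<in> aboveS s w"
      using tot z(1) w(1) by (auto simp: total_on_def aboveS_def)
    then show ?thesis
    proof cases
      case 1
      then show ?thesis
        unfolding omega_less_def using z w by (intro bexI[of _ z]) auto
    next
      case 2
      then show ?thesis
        unfolding omega_less_def using z w above_trans by (intro bexI[of _ w]) auto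
    next
      case 3
      then show ?thesis
        unfolding omega_less_def using z w above_trans by (intro bexI[of _ z]) auto
    qed
  qed
  have less_total: "omega_less s f g \<or> omega_less s g f"
    if fg: "f \<in> fin_supp_funs s" "g \<in> fin_supp_funs s" "f \<noteq> g" for f g
  proof -
    let ?C = "{x. f x \<noteq> g x}"
    have sub: "?C \<subseteq> {x. f x \<noteq> 0} \<union> {x. g x \<noteq> 0}" by auto
    have "finite ?C" "?C \<subseteq> Field s" "?C \<noteq> {}"
      using fg finite_subset[OF sub] sub by (auto simp: fin_supp_funs_def)
    then obtain z where z: "f z \<noteq> g z" "\<And>y. f y \<noteq> g y \<Longrightarrow> (y, z) \<in> s" "z \<in> Field s"
      using finite_has_greatest[OF s, of ?C] by auto
    have "f y = g y" if "y \<in> aboveS s z" for y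
      using z(2)[of y] that an by (auto simp: aboveS_def dest: antisymD)
    then show ?thesis
      using z(1,3) unfolding omega_less_def by (metis nat_neq_iff)
  qed
  have "Refl (omega_power s)"
    unfolding refl_on_def Field_omega_power by (auto simp: omega_power_alt)
  moreover have "trans (omega_power s)"
    using less_trans by (auto simp: omega_power_alt intro!: transI)
  moreover have "antisym (omega_power s)"
    using less_trans omega_less_irrefl unfolding antisym_def omega_power_alt by blast
  moreover have "Total (omega_power s)"
    unfolding total_on_def Field_omega_power using less_total by (auto simp: omega_power_alt)
  ultimately show ?thesis
    by (auto simp: order_on_defs refl_on_def Field_def)
qed

definition funs_below :: "'b rel \<Rightarrow> 'b \<Rightarrow> ('b \<Rightarrow> nat) set" where
  "funs_below s b = {f \<in> fin_supp_funs s. {x. f x \<noteq> 0} \<subseteq> underS s b}"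

lemma funs_below_mono:
  assumes "Linear_order s" "(a, b) \<in> s"
  shows "funs_below s a \<subseteq> funs_below s b"
proof -
  have "trans s" "antisym s"
    using assms(1) by (auto simp: order_on_defs)
  then have "underS s a \<subseteq> underS s b"
    using assms(2) by (auto simp: underS_def dest: transD antisymD)
  then show ?thesis by (auto simp: funs_below_def)
qed

lemma funs_below_eq_0: "f \<in> funs_below s b \<Longrightarrow> y \<notin> underS s b \<Longrightarrow> f y = 0"
  by (auto simp: funs_below_def)

text \<open>
  A leading coefficient coding a number \<open>n\<close> and a flag. It grows strictly with \<open>n\<close>, and for the same
  \<open>n\<close> the flag \<open>l\<close> outweighs all lower coefficients. Two values for every \<open>n\<close> are needed because a block
  of the tree has, besides its inner points, an end that comes after them.
\<close>

definition with_leading :: "'b \<Rightarrow> nat \<Rightarrow> bool \<Rightarrow> ('b \<Rightarrow> nat) \<Rightarrow> 'b \<Rightarrow> nat" where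
  "with_leading z n l f = f(z := if l then 2 * n + 2 else 2 * n + 1)"

lemma with_leading_fin_supp:
  assumes "f \<in> fin_supp_funs s" "z \<in> Field s"
  shows "with_leading z n l f \<in> fin_supp_funs s"
proof -
  have "{x. with_leading z n l f x \<noteq> 0} \<subseteq> insert z {x. f x \<noteq> 0}"
    by (auto simp: with_leading_def)
  moreover have "finite (insert z {x. f x \<noteq> 0})"
    using assms by (auto simp: fin_supp_funs_def)
  ultimately have "finite {x. with_leading z n l f x \<noteq> 0}"
    by (rule finite_subset)
  then show ?thesis
    using assms by (auto simp: fin_supp_funs_def with_leading_def)
qed

lemma with_leading_below:
  assumes "f \<in> funs_below s b" "z \<in> underS s b"
  shows "with_leading z n l f \<in> funs_below s b"
proof -
  have "with_leading z n l f \<in> fin_supp_funs s"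
    using assms by (intro with_leading_fin_supp) (auto simp: funs_below_def underS_def Field_def)
  moreover have "x \<in> underS s b" if "with_leading z n l f x \<noteq> 0" for x
    using that assms funs_below_eq_0[OF assms(1), of x] by (cases "x = z") (auto simp: with_leading_def)
  ultimately show ?thesis
    by (auto simp: funs_below_def)
qed

lemma with_leading_less_head:
  assumes s: "Linear_order s" and f: "f \<in> funs_below s z" and g: "g \<in> funs_below s w"
    and zw: "(z, w) \<in> s" and nm: "n < m"
  shows "omega_less s (with_leading z n l f) (with_leading w m l' g)"
  unfolding omega_less_def
proof (intro bexI conjI ballI)
  have tr: "trans s" and an: "antisym s"
    using s by (auto simp: order_on_defs)
  show "w \<in> Field s"
    using zw by (auto simp: Field_def)
  have fw: "f w = 0"
    using f zw an by (auto simp: funs_below_def underS_def dest: antisymD)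
  show "with_leading z n l f w < with_leading w m l' g w"
    using nm fw by (auto simp: with_leading_def)
  fix y assume y: "y \<in> aboveS s w"
  then have "y \<noteq> z" "y \<noteq> w" "y \<notin> underS s z" "y \<notin> underS s w"
    using zw tr an by (auto simp: aboveS_def underS_def dest: transD antisymD)
  then show "with_leading z n l f y = with_leading w m l' g y"
    using f g by (simp add: funs_below_eq_0 with_leading_def)
qed

lemma with_leading_less_tail:
  assumes "g \<in> funs_below s z" and less: "omega_less s f g"
  shows "omega_less s (with_leading z n l f) (with_leading z n l g)"
proof -
  obtain w where w: "w \<in> Field s" "f w < g w" "\<And>y. y \<in> aboveS s w \<Longrightarrow> f y = g y"
    using less unfolding omega_less_def by blast
  then have "w \<in> underS s z"
    using assms(1) by (force simp: funs_below_def)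
  then have "w \<noteq> z" by (simp add: underS_def)
  then show ?thesis
    unfolding omega_less_def using w by (intro bexI[of _ w]) (auto simp: with_leading_def)
qed

lemma with_leading_less_last:
  assumes s: "Linear_order s" and "f \<in> funs_below s z" "g \<in> funs_below s z" and z: "z \<in> Field s"
  shows "omega_less s (with_leading z n False f) (with_leading z n True g)"
  unfolding omega_less_def
proof (intro bexI conjI ballI)
  fix y assume y: "y \<in> aboveS s z"
  have "antisym s"
    using s by (auto simp: order_on_defs)
  then have "y \<notin> underS s z" "y \<noteq> z"
    using y by (auto simp: aboveS_def underS_def dest: antisymD)
  then show "with_leading z n False f y = with_leading z n True g y"
    using assms(2,3) by (simp add: funs_below_eq_0 with_leading_def)
qed (use z in \<open>auto simp: with_leading_def\<close>)

section \<open>Lists of numbers as points of the unit interval\<close>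

text \<open>
  The empty list is the point \<open>0\<close>, and the lists with head \<open>n\<close> form a copy, shrunk by the factor
  \<open>t ^ (n + 2)\<close>, that starts at distance \<open>t ^ (n + 1)\<close> from \<open>0\<close>. Thus every list is the limit, from the
  right, of its one-element extensions.
\<close>

primrec code :: "real \<Rightarrow> nat list \<Rightarrow> real" where
  "code t [] = 0"
| "code t (n # p) = t ^ Suc n * (1 + t * code t p)"

text \<open>
  The lexicographic order, except that a list comes after all its proper extensions, as a limit comes
  after the sequence converging to it. It is the reverse of the order of the codes.
\<close>

fun before :: "nat list \<Rightarrow> nat list \<Rightarrow> bool" where
  "before [] q \<longleftrightarrow> False"
| "before (n # p) [] \<longleftrightarrow> True"
| "before (n # p) (m # q) \<longleftrightarrow> n < m \<or> n = m \<and> before p q"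

lemma code_bounds:
  assumes "0 < t" "t \<le> 1/4"
  shows "0 \<le> code t p \<and> code t p \<le> 1/2"
proof (induction p)
  case (Cons n p)
  have "t ^ n \<le> 1"
    using assms by (intro power_le_one) auto
  then have "t * t ^ n \<le> 1/4 * 1"
    using assms by (intro mult_mono) auto
  then have tn: "t ^ Suc n \<le> 1/4" by simp
  have "t * code t p \<le> 1/4 * (1/2)"
    using assms Cons.IH by (intro mult_mono) auto
  then have "t ^ Suc n * (1 + t * code t p) \<le> 1/4 * 2"
    using assms Cons.IH tn by (intro mult_mono) auto
  then show ?case
    using assms Cons.IH by simp
qed simp

lemma code_Cons_bounds:
  assumes "0 < t" "t \<le> 1/4"
  shows "t ^ Suc n \<le> code t (n # p)" "code t (n # p) \<le> 2 * t ^ Suc n"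
proof -
  have c: "0 \<le> code t p" "code t p \<le> 1"
    using code_bounds[OF assms, of p] by auto
  have "t * code t p \<le> 1 * 1"
    using assms c by (intro mult_mono) auto
  moreover have "0 \<le> t * code t p"
    using assms c by simp
  moreover have "0 \<le> t ^ Suc n"
    using assms by simp
  ultimately have "t ^ Suc n * 1 \<le> t ^ Suc n * (1 + t * code t p)"
    and "t ^ Suc n * (1 + t * code t p) \<le> t ^ Suc n * 2"
    by (intro mult_left_mono; linarith)+
  then show "t ^ Suc n \<le> code t (n # p)" "code t (n # p) \<le> 2 * t ^ Suc n"
    by (simp_all only: code.simps mult_1_right mult.commute[of 2])
qed

lemma code_halves:
  assumes t: "0 < t" "t \<le> 1/4" and "n < m"
  shows "code t (m # q) \<le> code t (n # p) / 2"
proof -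
  have "code t (m # q) \<le> 2 * t ^ Suc m"
    by (rule code_Cons_bounds[OF t])
  also have "t ^ Suc m \<le> t ^ Suc (Suc n)"
    using assms by (intro power_decreasing) auto
  also have "2 * t ^ Suc (Suc n) \<le> 2 * (1/4 * t ^ Suc n)"
    using t by (simp add: mult_right_mono)
  also have "\<dots> \<le> code t (n # p) / 2"
    using code_Cons_bounds(1)[OF t, of n p] by simp
  finally show ?thesis by simp
qed

lemma code_strict_antimono_iff:
  assumes t: "0 < t" "t \<le> 1/4"
  shows "before p q \<longleftrightarrow> code t q < code t p"
proof (induction p q rule: before.induct)
  case (1 q)
  then show ?case using code_bounds[OF t, of q] by simp
next
  case (2 n p)
  then show ?case using code_Cons_bounds(1)[OF t, of n p] t by (simp add: less_le_trans)
next
  case (3 n p m q)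
  have pos: "0 < code t (k # r)" for k r
    using code_Cons_bounds(1)[OF t, of k r] zero_less_power[OF t(1), of "Suc k"] by linarith
  consider "n < m" | "n = m" | "m < n" by linarith
  then show ?case
  proof cases
    case 1
    then show ?thesis
      using code_halves[OF t 1, of q p] pos[of n p] by simp
  next
    case 2
    then show ?thesis
      using 3 t by simp
  next
    case 3
    then show ?thesis
      using code_halves[OF t 3, of p q] pos[of m q] by simp
  qed
qed

lemma before_total: "p \<noteq> q \<Longrightarrow> before p q \<or> before q p"
proof (induction p q rule: before.induct)
  case (1 q)
  then show ?case by (cases q) auto
qed auto

lemma before_irrefl: "\<not> before p p"
  using code_strict_antimono_iff[of "1/4" p p] by simp

lemma before_trans: "before p q \<Longrightarrow> before q r \<Longrightarrow> before p r"
  using code_strict_antimono_iff[of "1/4"] by (simp add: less_trans)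

lemma code_inj:
  assumes "0 < t" "t \<le> 1/4"
  shows "inj (code t)"
  using before_total code_strict_antimono_iff[OF assms] by (metis injI less_irrefl)

text \<open>
  The points of different blocks are so far apart that their distance is at least half the distance of
  either from \<open>0\<close>. Hence a map that moves no point away from \<open>0\<close> distorts such distances by at most
  \<open>2\<close>, and only pairs with the same head need to be considered.
\<close>

lemma code_map_lipschitz:
  assumes t: "0 < t" "t \<le> 1/4"
    and small: "\<And>p. p \<in> P \<Longrightarrow> code t (G p) \<le> code t p"
    and heads: "\<And>n p q. n # p \<in> P \<Longrightarrow> n # q \<in> P \<Longrightarrow>
      \<bar>code t (G (n # p)) - code t (G (n # q))\<bar> \<le> 2 * \<bar>code t (n # p) - code t (n # q)\<bar>"
    and p: "p \<in> P" and q: "q \<in> P"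
  shows "\<bar>code t (G p) - code t (G q)\<bar> \<le> 2 * \<bar>code t p - code t q\<bar>"
proof -
  have far: "\<bar>code t (G p) - code t (G q)\<bar> \<le> 2 * \<bar>code t p - code t q\<bar>"
    if "p \<in> P" "q \<in> P" "code t q \<le> code t p / 2" for p q
  proof -
    have "\<bar>code t (G p) - code t (G q)\<bar> \<le> max (code t (G p)) (code t (G q))"
      using code_bounds[OF t, of "G p"] code_bounds[OF t, of "G q"] by (auto simp: abs_if)
    also have "\<dots> \<le> code t p"
      using small[OF that(1)] small[OF that(2)] that(3) code_bounds[OF t, of p] by simp
    also have "\<dots> \<le> 2 * (code t p - code t q)"
      using that(3) by (simp add: field_simps)
    also have "\<dots> \<le> 2 * \<bar>code t p - code t q\<bar>"
      by (intro mult_left_mono abs_ge_self) simp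
    finally show ?thesis .
  qed
  have far': "\<bar>code t (G p) - code t (G q)\<bar> \<le> 2 * \<bar>code t p - code t q\<bar>"
    if "p \<in> P" "q \<in> P" "code t p \<le> code t q / 2" for p q
    using far[OF that(2,1,3)] by (simp add: abs_minus_commute)
  show ?thesis
  proof (cases p)
    case Nil
    then show ?thesis using far'[OF p q] code_bounds[OF t, of q] by simp
  next
    case p': (Cons n p')
    show ?thesis
    proof (cases q)
      case Nil
      then show ?thesis using far[OF p q] code_bounds[OF t, of p] by simp
    next
      case q': (Cons m q')
      consider "n < m" | "n = m" | "m < n" by linarith
      then show ?thesis
      proof cases
        case 1
        then show ?thesis using far[OF p q] code_halves[OF t 1] p' q' by simp
      next
        case 2
        then show ?thesis using heads p q p' q' by simp
      next
        case 3
        then show ?thesis using far'[OF p q] code_halves[OF t 3] p' q' by simp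
      qed
    qed
  qed
qed

definition before_wf :: "nat list set \<Rightarrow> bool" where
  "before_wf T \<longleftrightarrow> (\<forall>B\<subseteq>T. B \<noteq> {} \<longrightarrow> (\<exists>p\<in>B. \<forall>q\<in>B. \<not> before q p))"

lemma before_wf_subset: "before_wf T \<Longrightarrow> A \<subseteq> T \<Longrightarrow> before_wf A"
  unfolding before_wf_def by (meson subset_trans)

text \<open>
  The least element has the least head and, among the lists with that head, the least tail.
\<close>

lemma before_wf_Cons:
  assumes tails: "\<And>n. before_wf {p. n # p \<in> T}"
  shows "before_wf T"
  unfolding before_wf_def
proof (intro allI impI)
  fix B assume B: "B \<subseteq> T" "B \<noteq> {}"
  show "\<exists>p\<in>B. \<forall>q\<in>B. \<not> before q p"
  proof (cases "B \<subseteq> {[]}")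
    case True
    then have "\<not> before q p" if "p \<in> B" "q \<in> B" for p q
      using that by auto
    then show ?thesis using B(2) by blast
  next
    case False
    then obtain r where "r \<in> B" "r \<noteq> []"
      by blast
    then obtain n p where np: "n # p \<in> B"
      by (cases r) auto
    define m where "m = (LEAST n. \<exists>p. n # p \<in> B)"
    have ex: "\<exists>p. m # p \<in> B"
      unfolding m_def by (rule LeastI[of "\<lambda>n. \<exists>p. n # p \<in> B" n]) (use np in blast)
    have least: "m \<le> k" if "k # q \<in> B" for k q
      unfolding m_def by (rule Least_le) (use that in blast)
    have "{p. m # p \<in> B} \<subseteq> {p. m # p \<in> T}" "{p. m # p \<in> B} \<noteq> {}"
      using B(1) ex by auto
    then have "\<exists>q\<in>{p. m # p \<in> B}. \<forall>q'\<in>{p. m # p \<in> B}. \<not> before q' q"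
      using tails[of m] unfolding before_wf_def by (elim allE[of _ "{p. m # p \<in> B}"] impE)
    then obtain q where q: "m # q \<in> B" "\<And>q'. m # q' \<in> B \<Longrightarrow> \<not> before q' q"
      by blast
    have "\<not> before r (m # q)" if r: "r \<in> B" for r
    proof (cases r)
      case (Cons k r')
      then show ?thesis
        using r least[of k r'] q(2)[of r'] by auto
    qed simp
    then show ?thesis using q(1) by blast
  qed
qed

definition list_order :: "nat list set \<Rightarrow> nat list rel" where
  "list_order A = {(p, q). p \<in> A \<and> q \<in> A \<and> (p = q \<or> before p q)}"

lemma Field_list_order: "Field (list_order A) = A"
  by (auto simp: list_order_def Field_def)

lemma underS_list_order: "p \<in> underS (list_order A) q \<longleftrightarrow> p \<in> A \<and> q \<in> A \<and> before p q"
  using before_irrefl by (auto simp: list_order_def underS_def)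

lemma Well_order_list_order:
  assumes "before_wf A"
  shows "Well_order (list_order A)"
proof -
  have "Refl (list_order A)"
    unfolding refl_on_def Field_list_order by (auto simp: list_order_def)
  moreover have "trans (list_order A)"
    using before_trans by (auto simp: list_order_def intro!: transI)
  moreover have "antisym (list_order A)"
    using before_trans before_irrefl unfolding antisym_def list_order_def by blast
  moreover have "Total (list_order A)"
    unfolding total_on_def Field_list_order using before_total by (auto simp: list_order_def)
  moreover have "wf (list_order A - Id)"
  proof (rule wfI_min)
    fix x Q assume x: "x \<in> (Q :: nat list set)"
    show "\<exists>z\<in>Q. \<forall>y. (y, z) \<in> list_order A - Id \<longrightarrow> y \<notin> Q"
    proof (cases "x \<in> A")
      case True
      then obtain z where "z \<in> Q \<inter> A" "\<forall>q\<in>Q \<inter> A. \<not> before q z"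
        using assms x unfolding before_wf_def by (metis IntI Int_lower2 empty_iff)
      then show ?thesis by (auto simp: list_order_def)
    next
      case False
      then show ?thesis using x by (auto simp: list_order_def)
    qed
  qed
  ultimately show ?thesis
    by (auto simp: order_on_defs well_order_on_def refl_on_def Field_def)
qed

section \<open>Lists with descending exponents\<close>

text \<open>
  The exponents are the elements of a countable successor ordinal \<open>s\<close> with greatest element \<open>\<tau>\<close>.
  Each of them occurs infinitely often in the enumeration \<open>e\<close>, so that every node of the tree of descending lists has
  infinitely many children with each smaller exponent; that is what makes the node with exponent \<open>b\<close>
  a point of Cantor-Bendixson rank \<open>b\<close>, whatever the order of the enumeration.
\<close>

locale exponent_enumeration =
  fixes s :: "'b rel" and e :: "nat \<Rightarrow> 'b" and \<tau> :: 'b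
  assumes Well_order: "Well_order s"
    and e_Field: "e n \<in> Field s"
    and infinite_fibre: "b \<in> Field s \<Longrightarrow> infinite {n. e n = b}"
    and top_Field: "\<tau> \<in> Field s"
    and top_greatest: "b \<in> Field s \<Longrightarrow> (b, \<tau>) \<in> s"
begin

lemma Linear_order: "Linear_order s"
  using Well_order by (simp add: well_order_on_def)

lemma wf_s: "wf (s - Id)"
  using Well_order by (simp add: well_order_on_def)

lemma s_refl: "b \<in> Field s \<Longrightarrow> (b, b) \<in> s"
  using Linear_order by (auto simp: order_on_defs refl_on_def)

lemma s_trans: "(a, b) \<in> s \<Longrightarrow> (b, c) \<in> s \<Longrightarrow> (a, c) \<in> s"
  using Linear_order unfolding order_on_defs by (blast dest: transD)

lemma s_antisym: "(a, b) \<in> s \<Longrightarrow> (b, a) \<in> s \<Longrightarrow> a = b"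
  using Linear_order unfolding order_on_defs by (blast dest: antisymD)

lemma underS_trans: "a \<in> underS s b \<Longrightarrow> (b, c) \<in> s \<Longrightarrow> a \<in> underS s c"
  using s_trans s_antisym unfolding underS_def by blast

primrec descending :: "'b \<Rightarrow> nat list \<Rightarrow> bool" where
  "descending b [] \<longleftrightarrow> True"
| "descending b (n # p) \<longleftrightarrow> e n \<in> underS s b \<and> descending (e n) p"

definition paths :: "'b \<Rightarrow> nat list set" where
  "paths b = {p. descending b p}"

lemma descending_mono: "descending a p \<Longrightarrow> (a, b) \<in> s \<Longrightarrow> descending b p"
  by (cases p) (auto intro: underS_trans)

lemma before_wf_paths: "b \<in> Field s \<Longrightarrow> before_wf (paths b)"
proof (induction b rule: wf_induct_rule[OF wf_s])
  case (1 b)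
  show ?case
  proof (rule before_wf_Cons)
    fix n
    show "before_wf {p. n # p \<in> paths b}"
    proof (cases "e n \<in> underS s b")
      case True
      then have "(e n, b) \<in> s - Id"
        by (auto simp: underS_def)
      then have "before_wf (paths (e n))"
        using e_Field by (intro 1)
      then show ?thesis
        by (rule before_wf_subset) (auto simp: paths_def)
    next
      case False
      then show ?thesis by (simp add: paths_def before_wf_def)
    qed
  qed
qed

text \<open>
  The root has one child with the greatest exponent \<open>\<tau>\<close> for each number, irrespective of \<open>e\<close>; so
  shifting the first entry of a list is a similarity of the tree into itself.
\<close>

definition top_paths :: "nat list set" where
  "top_paths = {n # p | n p. p \<in> paths \<tau>}"

lemma before_wf_top_paths: "before_wf top_paths"
  by (rule before_wf_Cons) (simp add: top_paths_def before_wf_paths top_Field)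

definition increasing_funs :: "('b \<Rightarrow> nat) set \<Rightarrow> (('b \<Rightarrow> nat) \<Rightarrow> nat list) \<Rightarrow> bool" where
  "increasing_funs D u \<longleftrightarrow> (\<forall>f\<in>D. \<forall>g\<in>D. omega_less s f g \<longrightarrow> before (u f) (u g))"

lemma underS_Restr: "x \<in> underS (Restr r D) y \<longleftrightarrow> x \<in> D \<and> y \<in> D \<and> x \<in> underS r y"
  by (auto simp: underS_def)

text \<open>
  Let \<open>c\<close> be the leading exponent of \<open>f\<close>. A function \<open>g\<close> below \<open>f\<close> has no exponent above \<open>c\<close>, and its
  coefficient at \<open>c\<close> is at most \<open>f c\<close>; so the functions below \<open>f\<close> lie in \<open>f c + 1\<close> successive
  copies of \<open>funs_below s c\<close>. These are sent by \<open>u c\<close> into as many successive branches of \<open>A\<close> that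
  contain all of \<open>paths c\<close>.
\<close>

lemma funs_segment_embeds:
  assumes S: "S \<subseteq> Field s"
    and D: "D = {f \<in> fin_supp_funs s. {x. f x \<noteq> 0} \<subseteq> S}"
    and u: "\<And>b. b \<in> S \<Longrightarrow> u b ` funs_below s b \<subseteq> paths b \<and> increasing_funs (funs_below s b) (u b)"
    and A: "A \<noteq> {}" "\<And>b. b \<in> S \<Longrightarrow> infinite {n. \<forall>p\<in>paths b. n # p \<in> A}"
    and f: "f \<in> D"
  shows "\<exists>b\<in>A. \<exists>h. \<forall>g\<in>D. omega_less s g f \<longrightarrow> h g \<in> A \<and> before (h g) b \<and>
    (\<forall>g'\<in>D. omega_less s g' f \<longrightarrow> omega_less s g g' \<longrightarrow> before (h g) (h g'))"
proof (cases "{x. f x \<noteq> 0} = {}")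
  case True
  then have "\<not> omega_less s g f" for g
    by (auto simp: omega_less_def)
  then show ?thesis
    using A(1) by blast
next
  case False
  have "finite {x. f x \<noteq> 0}" "{x. f x \<noteq> 0} \<subseteq> Field s"
    using f D by (auto simp: fin_supp_funs_def)
  then obtain c where c: "f c \<noteq> 0" "\<And>y. f y \<noteq> 0 \<Longrightarrow> (y, c) \<in> s"
    using finite_has_greatest[OF Linear_order _ False] by auto
  have cS: "c \<in> S"
    using f D c(1) by auto
  define N where "N = {n. \<forall>p\<in>paths c. n # p \<in> A}"
  \<comment> \<open>The coefficient \<open>k\<close> at \<open>c\<close> selects the \<open>k\<close>-th branch of \<open>A\<close> that has room for \<open>paths c\<close>.\<close>
  define i where "i = enumerate N"
  have N: "infinite N"
    unfolding N_def using A(2)[OF cS] .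
  have iN: "i k \<in> N" for k
    unfolding i_def using N by (rule enumerate_in_set)
  have i_less: "i k < i l" if "k < l" for k l
    unfolding i_def using that N by (rule enumerate_mono)
  define cut where "cut g = g(c := (0::nat))" for g :: "'b \<Rightarrow> nat"
  define h where "h g = i (g c) # u c (cut g)" for g
  have zero_above: "g y = 0" if gD: "g \<in> D" and gf: "omega_less s g f" and yc: "(y, c) \<notin> s" for g y
  proof -
    have fy: "f y = 0" using c(2) yc by blast
    obtain z where z: "g z < f z" "\<And>y. y \<in> aboveS s z \<Longrightarrow> g y = f y"
      using gf unfolding omega_less_def by blast
    then have zc: "(z, c) \<in> s" using c(2)[of z] by simp
    show ?thesis
    proof (rule ccontr)
      assume g: "g y \<noteq> 0"
      then have "y \<in> Field s" using gD D S by auto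
      moreover have "z \<in> Field s" using zc by (auto simp: Field_def)
      ultimately have "y = z \<or> (y, z) \<in> s \<or> y \<in> aboveS s z"
        using Linear_order by (auto simp: order_on_defs total_on_def aboveS_def)
      then show False
        using z(2)[of y] fy g zc s_trans yc by auto
    qed
  qed
  have le: "g c \<le> f c" if gf: "omega_less s g f" for g
  proof -
    obtain z where z: "g z < f z" "\<And>y. y \<in> aboveS s z \<Longrightarrow> g y = f y"
      using gf unfolding omega_less_def by blast
    then have "(z, c) \<in> s" using c(2)[of z] by simp
    then have "z = c \<or> c \<in> aboveS s z" by (auto simp: aboveS_def)
    then show ?thesis using z by auto
  qed
  have cut: "cut g \<in> funs_below s c" if g: "g \<in> D" "omega_less s g f" for g
  proof -
    have "{x. cut g x \<noteq> 0} \<subseteq> {x. g x \<noteq> 0}" by (auto simp: cut_def)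
    moreover have "finite {x. g x \<noteq> 0}" "{x. g x \<noteq> 0} \<subseteq> Field s"
      using g(1) D by (auto simp: fin_supp_funs_def)
    ultimately have "cut g \<in> fin_supp_funs s"
      unfolding fin_supp_funs_def by (auto intro: finite_subset)
    moreover have "x \<in> underS s c" if "cut g x \<noteq> 0" for x
      using that zero_above[OF g, of x] by (auto simp: cut_def underS_def split: if_splits)
    ultimately show ?thesis
      by (auto simp: funs_below_def)
  qed
  have tail: "u c (cut g) \<in> paths c" if "g \<in> D" "omega_less s g f" for g
    using u[OF cS] cut[OF that] by blast
  have "(\<lambda>_. 0) \<in> funs_below s c"
    by (auto simp: funs_below_def fin_supp_funs_def)
  then have "u c (\<lambda>_. 0) \<in> paths c"
    using u[OF cS] by blast
  then have bA: "i (Suc (f c)) # u c (\<lambda>_. 0) \<in> A"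
    using iN unfolding N_def by blast
  have "h g \<in> A \<and> before (h g) (i (Suc (f c)) # u c (\<lambda>_. 0)) \<and>
      (\<forall>g'\<in>D. omega_less s g' f \<longrightarrow> omega_less s g g' \<longrightarrow> before (h g) (h g'))"
    if g: "g \<in> D" "omega_less s g f" for g
  proof (intro conjI ballI impI)
    show "h g \<in> A"
      using iN[of "g c"] tail[OF g] unfolding h_def N_def by blast
    show "before (h g) (i (Suc (f c)) # u c (\<lambda>_. 0))"
      using le[OF g(2)] i_less by (simp add: h_def)
    fix g' assume g': "g' \<in> D" "omega_less s g' f" and less: "omega_less s g g'"
    obtain z where z: "z \<in> Field s" "g z < g' z" "\<And>y. y \<in> aboveS s z \<Longrightarrow> g y = g' y"
      using less unfolding omega_less_def by blast
    have zc: "(z, c) \<in> s"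
      using zero_above[OF g', of z] z(2) by auto
    show "before (h g) (h g')"
    proof (cases "z = c")
      case True
      then show ?thesis
        using z(2) i_less by (simp add: h_def)
    next
      case False
      then have eq: "g c = g' c"
        using z(3)[of c] zc by (simp add: aboveS_def)
      have "omega_less s (cut g) (cut g')"
        unfolding omega_less_def cut_def using z False by (intro bexI[of _ z]) auto
      then have "before (u c (cut g)) (u c (cut g'))"
        using u[OF cS] cut[OF g] cut[OF g'] unfolding increasing_funs_def by blast
      then show ?thesis
        using eq by (simp add: h_def)
    qed
  qed
  then show ?thesis
    using bA by (intro bexI[of _ "i (Suc (f c)) # u c (\<lambda>_. 0)"] exI[of _ h]) blast+
qed

lemma Restr_omega_power_ordLeq:
  assumes S: "S \<subseteq> Field s"
    and D: "D = {f \<in> fin_supp_funs s. {x. f x \<noteq> 0} \<subseteq> S}"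
    and u: "\<And>b. b \<in> S \<Longrightarrow> u b ` funs_below s b \<subseteq> paths b \<and> increasing_funs (funs_below s b) (u b)"
    and A: "A \<noteq> {}" "\<And>b. b \<in> S \<Longrightarrow> infinite {n. \<forall>p\<in>paths b. n # p \<in> A}" "before_wf A"
  shows "(Restr (omega_power s) D, list_order A) \<in> ordLeq"
proof (rule ordLeq_if_segments_embed)
  show "Linear_order (Restr (omega_power s) D)"
    by (rule Linear_order_Restr[OF Linear_order_omega_power[OF Linear_order]])
  show "Well_order (list_order A)"
    using A(3) by (rule Well_order_list_order)
  fix f assume "f \<in> Field (Restr (omega_power s) D)"
  then have "f \<in> D" by (auto simp: Field_def)
  then obtain b h where b: "b \<in> A" and h: "\<And>g. g \<in> D \<Longrightarrow> omega_less s g f \<Longrightarrow> h g \<in> A"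
    "\<And>g. g \<in> D \<Longrightarrow> omega_less s g f \<Longrightarrow> before (h g) b"
    "\<And>g g'. g \<in> D \<Longrightarrow> omega_less s g f \<Longrightarrow> g' \<in> D \<Longrightarrow> omega_less s g' f \<Longrightarrow> omega_less s g g' \<Longrightarrow>
      before (h g) (h g')"
    using funs_segment_embeds[OF S D u A(1,2)] by metis
  have seg: "g \<in> D \<and> omega_less s g f" if "g \<in> underS (Restr (omega_power s) D) f" for g
    using that by (simp add: underS_Restr underS_omega_power)
  have "h ` underS (Restr (omega_power s) D) f \<subseteq> underS (list_order A) b"
    using seg h(1,2) b by (auto simp: underS_list_order)
  moreover have "monotone_on (underS (Restr (omega_power s) D) f)
      (\<lambda>x y. x \<in> underS (Restr (omega_power s) D) y) (\<lambda>x y. x \<in> underS (list_order A) y) h"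
  proof (rule monotone_onI)
    fix g g' assume g: "g \<in> underS (Restr (omega_power s) D) f" "g' \<in> underS (Restr (omega_power s) D) f"
      and gg': "g \<in> underS (Restr (omega_power s) D) g'"
    then have "omega_less s g g'"
      by (simp add: underS_Restr underS_omega_power)
    then show "h g \<in> underS (list_order A) (h g')"
      using seg[OF g(1)] seg[OF g(2)] h by (simp add: underS_list_order)
  qed
  ultimately show "\<exists>b\<in>Field (list_order A).
      \<exists>h. h ` underS (Restr (omega_power s) D) f \<subseteq> underS (list_order A) b \<and>
        monotone_on (underS (Restr (omega_power s) D) f)
          (\<lambda>x y. x \<in> underS (Restr (omega_power s) D) y) (\<lambda>x y. x \<in> underS (list_order A) y) h"
    using b unfolding Field_list_order by blast
qed

lemma ordLeq_imp_increasing_funs: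
  assumes le: "(Restr (omega_power s) D, list_order A) \<in> ordLeq" and D: "D \<subseteq> fin_supp_funs s"
  shows "\<exists>u. u ` D \<subseteq> A \<and> increasing_funs D u"
proof -
  obtain u where wo: "Well_order (Restr (omega_power s) D)"
    and u: "embed (Restr (omega_power s) D) (list_order A) u"
    using le by (auto simp: ordLeq_def)
  have F: "Field (Restr (omega_power s) D) = D"
    using D by (auto simp: Field_def omega_power_alt)
  have "u ` D \<subseteq> A"
    using embed_Field[OF u] by (simp add: F Field_list_order)
  moreover have "before (u f) (u g)" if fg: "f \<in> D" "g \<in> D" "omega_less s f g" for f g
  proof -
    have "f \<in> underS (Restr (omega_power s) D) g"
      using fg D by (auto simp: underS_Restr underS_omega_power)
    then have "u f \<in> underS (list_order A) (u g)"
      using embed_underS[OF wo u, of g] fg(2) F by (auto simp: bij_betw_def)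
    then show ?thesis
      by (simp add: underS_list_order)
  qed
  ultimately show ?thesis
    unfolding increasing_funs_def by blast
qed

text \<open>
  This is the lower bound for the order type of \<open>paths b\<close>: as the enumeration of the exponents need
  not be increasing, the embedding is obtained from the comparison of initial segments and not from a
  formula. If there is no exponent below \<open>b\<close>, then \<open>funs_below s b\<close> contains only zero, which is sent
  to the empty list; otherwise the empty list is not used.
\<close>

lemma funs_below_embed_paths:
  "b \<in> Field s \<Longrightarrow> \<exists>u. u ` funs_below s b \<subseteq> paths b \<and> increasing_funs (funs_below s b) u"
proof (induction b rule: wf_induct_rule[OF wf_s])
  case (1 b)
  have "\<exists>u. u ` funs_below s c \<subseteq> paths c \<and> increasing_funs (funs_below s c) u" if "c \<in> underS s b" for c
    using that by (intro 1) (auto simp: underS_def Field_def)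
  then obtain u where u: "\<And>c. c \<in> underS s b \<Longrightarrow>
      u c ` funs_below s c \<subseteq> paths c \<and> increasing_funs (funs_below s c) (u c)"
    by metis
  show ?case
  proof (cases "underS s b = {}")
    case True
    then have "funs_below s b \<subseteq> {\<lambda>_. 0}"
      by (auto simp: funs_below_def)
    then have "increasing_funs (funs_below s b) (\<lambda>_. [])"
      using omega_less_irrefl unfolding increasing_funs_def by blast
    then show ?thesis
      by (intro exI[of _ "\<lambda>_. []"]) (auto simp: paths_def)
  next
    case False
    let ?A = "paths b - {[]}"
    have sub: "{n. e n = c} \<subseteq> {n. \<forall>p\<in>paths c. n # p \<in> ?A}" if "c \<in> underS s b" for c
      using that by (auto simp: paths_def)
    have inf: "infinite {n. \<forall>p\<in>paths c. n # p \<in> ?A}" if "c \<in> underS s b" for c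
      using infinite_super[OF sub[OF that]] infinite_fibre[of c] that
      by (auto simp: underS_def Field_def)
    obtain c where c: "c \<in> underS s b" using False by blast
    obtain n where "\<forall>p\<in>paths c. n # p \<in> ?A"
      using infinite_imp_nonempty[OF inf[OF c]] by blast
    moreover have "[] \<in> paths c" by (simp add: paths_def)
    ultimately have ne: "?A \<noteq> {}" by blast
    have "before_wf ?A"
      using before_wf_paths[OF "1.prems"] by (rule before_wf_subset) auto
    then have "(Restr (omega_power s) (funs_below s b), list_order ?A) \<in> ordLeq"
      by (intro Restr_omega_power_ordLeq[of "underS s b", OF _ funs_below_def u ne inf])
        (auto simp: underS_def Field_def)
    then show ?thesis
      using ordLeq_imp_increasing_funs[of "funs_below s b" ?A] by (force simp: funs_below_def)
  qed
qed

lemma omega_power_ordLeq_top_paths: "(omega_power s, list_order top_paths) \<in> ordLeq"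
proof -
  obtain u where u: "\<And>c. c \<in> Field s \<Longrightarrow>
      u c ` funs_below s c \<subseteq> paths c \<and> increasing_funs (funs_below s c) (u c)"
    using funs_below_embed_paths by metis
  have "top_paths \<noteq> {}"
    by (auto simp: top_paths_def paths_def intro: exI[of _ "[]"])
  moreover have "{n. \<forall>p\<in>paths c. n # p \<in> top_paths} = UNIV" if "c \<in> Field s" for c
    using descending_mono[OF _ top_greatest[OF that]] by (auto simp: top_paths_def paths_def)
  moreover have "fin_supp_funs s = {f \<in> fin_supp_funs s. {x. f x \<noteq> 0} \<subseteq> Field s}"
    by (auto simp: fin_supp_funs_def)
  ultimately have "(Restr (omega_power s) (fin_supp_funs s), list_order top_paths) \<in> ordLeq"
    using before_wf_top_paths by (intro Restr_omega_power_ordLeq[of "Field s", OF _ _ u]) auto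
  then show ?thesis
    by (metis Field_omega_power Restr_Field)
qed

text \<open>
  Blocks come in the order of their indices, not of their exponents. The running maximum of the
  exponents is the leading exponent that absorbs all blocks up to the index \<open>n\<close>.
\<close>

definition max_exponent :: "'b \<Rightarrow> nat \<Rightarrow> 'b" where
  "max_exponent b n = (SOME z. z \<in> {e m |m. m \<le> n \<and> e m \<in> underS s b} \<and>
     (\<forall>y\<in>{e m |m. m \<le> n \<and> e m \<in> underS s b}. (y, z) \<in> s))"

lemma max_exponent:
  assumes "e n \<in> underS s b"
  shows "max_exponent b n \<in> {e m |m. m \<le> n \<and> e m \<in> underS s b}"
    "\<And>m. m \<le> n \<Longrightarrow> e m \<in> underS s b \<Longrightarrow> (e m, max_exponent b n) \<in> s"
proof -
  let ?C = "{e m |m. m \<le> n \<and> e m \<in> underS s b}"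
  have "?C \<subseteq> e ` {..n}" by auto
  then have "finite ?C" "?C \<subseteq> Field s"
    using finite_subset e_Field by blast+
  then have "\<exists>z\<in>?C. \<forall>y\<in>?C. (y, z) \<in> s"
    using assms by (intro finite_has_greatest[OF Linear_order]) auto
  then have "\<exists>z. z \<in> ?C \<and> (\<forall>y\<in>?C. (y, z) \<in> s)"
    by (simp only: Bex_def)
  from someI_ex[OF this] have "max_exponent b n \<in> ?C \<and> (\<forall>y\<in>?C. (y, max_exponent b n) \<in> s)"
    unfolding max_exponent_def .
  then show "max_exponent b n \<in> ?C"
    and "\<And>m. m \<le> n \<Longrightarrow> e m \<in> underS s b \<Longrightarrow> (e m, max_exponent b n) \<in> s"
    by blast+
qed

text \<open>
  A strictly increasing map from the nonempty lists to \<open>funs_below s b\<close>: the head becomes a leading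
  coefficient at the running maximum of the exponents, the tail gives the lower coefficients, and the
  flag puts the end of a block above all its other points. For the upper bound of the order type a map
  is enough; it need not be onto.
\<close>

primrec path_fun :: "nat list \<Rightarrow> 'b \<Rightarrow> 'b \<Rightarrow> nat" where
  "path_fun [] b = (\<lambda>_. 0)"
| "path_fun (n # p) b = with_leading (max_exponent b n) n (p = []) (path_fun p (e n))"

lemma path_fun_below: "descending b p \<Longrightarrow> path_fun p b \<in> funs_below s b"
proof (induction p arbitrary: b)
  case Nil
  then show ?case by (simp add: funs_below_def fin_supp_funs_def)
next
  case (Cons n p)
  then have f: "path_fun p (e n) \<in> funs_below s (e n)" and n: "e n \<in> underS s b"
    by auto
  have z: "max_exponent b n \<in> underS s b"
    using max_exponent(1)[OF n] by auto
  have eb: "(e n, b) \<in> s"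
    using n by (simp add: underS_def)
  have f': "path_fun p (e n) \<in> funs_below s b"
    using funs_below_mono[OF Linear_order eb] f by blast
  then show ?case
    using with_leading_below z by auto
qed

lemma path_fun_increasing:
  "descending b p \<Longrightarrow> descending b q \<Longrightarrow> before p q \<Longrightarrow> q \<noteq> [] \<Longrightarrow>
    omega_less s (path_fun p b) (path_fun q b)"
proof (induction p q arbitrary: b rule: before.induct)
  case (3 n p m q)
  have n: "e n \<in> underS s b" and m: "e m \<in> underS s b"
    using "3.prems" by auto
  have fn: "path_fun p (e n) \<in> funs_below s (max_exponent b n)"
    using path_fun_below[of "e n" p] "3.prems" funs_below_mono[OF Linear_order max_exponent(2)[OF n order_refl n]]
    by auto
  have fm: "path_fun q (e m) \<in> funs_below s (max_exponent b m)"
    using path_fun_below[of "e m" q] "3.prems" funs_below_mono[OF Linear_order max_exponent(2)[OF m order_refl m]]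
    by auto
  show ?case
  proof (cases "n < m")
    case True
    \<comment> \<open>The running maximum does not decrease.\<close>
    obtain k where "k \<le> n" "e k \<in> underS s b" "max_exponent b n = e k"
      using max_exponent(1)[OF n] by blast
    then have "(max_exponent b n, max_exponent b m) \<in> s"
      using max_exponent(2)[OF m, of k] True by simp
    then show ?thesis
      using with_leading_less_head[OF Linear_order fn fm _ True] by simp
  next
    case False
    then have nm: "n = m" and pq: "before p q"
      using "3.prems"(3) by auto
    then have p: "p \<noteq> []" by auto
    show ?thesis
    proof (cases "q = []")
      case True
      have "max_exponent b n \<in> Field s"
        using max_exponent(1)[OF n] e_Field by auto
      then show ?thesis
        using with_leading_less_last[OF Linear_order fn, of "path_fun q (e m)"] fm nm p True by simp
    next
      case False
      then have "omega_less s (path_fun p (e n)) (path_fun q (e m))"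
        using "3.IH"[of "e n"] "3.prems" nm pq by simp
      then show ?thesis
        using with_leading_less_tail[OF fm] nm p False by simp
    qed
  qed
qed auto

lemma top_paths_ordLeq_omega_power: "(list_order top_paths, omega_power s) \<in> ordLeq"
proof (rule ordLeq_if_segments_embed)
  show "Linear_order (list_order top_paths)"
    using Well_order_list_order[OF before_wf_top_paths] by (simp add: well_order_on_def)
  show "Well_order (omega_power s)"
    using omega_power_ordLeq_top_paths by (simp add: ordLeq_def)
  define v where "v q = with_leading \<tau> (hd q) (tl q = []) (path_fun (tl q) \<tau>)" for q
  have v_in: "v q \<in> fin_supp_funs s" if "q \<in> top_paths" for q
    using that path_fun_below[of \<tau> "tl q"] top_Field unfolding v_def
    by (intro with_leading_fin_supp) (auto simp: top_paths_def paths_def funs_below_def)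
  have v_less: "omega_less s (v p) (v q)" if pq: "p \<in> top_paths" "q \<in> top_paths" "before p q" for p q
  proof -
    obtain n p' m q' where eq: "p = n # p'" "q = m # q'" and d: "descending \<tau> p'" "descending \<tau> q'"
      using pq(1,2) by (auto simp: top_paths_def paths_def)
    note below = path_fun_below[OF d(1)] path_fun_below[OF d(2)]
    show ?thesis
    proof (cases "n < m")
      case True
      then show ?thesis
        using with_leading_less_head[OF Linear_order below s_refl[OF top_Field] True] eq by (simp add: v_def)
    next
      case False
      then have nm: "n = m" and less: "before p' q'"
        using pq(3) eq by auto
      then have "p' \<noteq> []" by auto
      show ?thesis
      proof (cases "q' = []")
        case True
        then show ?thesis
          using with_leading_less_last[OF Linear_order below top_Field] eq nm \<open>p' \<noteq> []\<close> by (simp add: v_def)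
      next
        case False
        then show ?thesis
          using with_leading_less_tail[OF below(2) path_fun_increasing[OF d less]] eq nm \<open>p' \<noteq> []\<close>
          by (simp add: v_def)
      qed
    qed
  qed
  have v_mono: "v p \<in> underS (omega_power s) (v q)" if "p \<in> underS (list_order top_paths) q" for p q
    using that v_in v_less by (simp add: underS_list_order underS_omega_power)
  fix q assume "q \<in> Field (list_order top_paths)"
  then have "v q \<in> Field (omega_power s)"
    using v_in by (simp add: Field_list_order Field_omega_power)
  moreover have "v ` underS (list_order top_paths) q \<subseteq> underS (omega_power s) (v q)"
    using v_mono by blast
  moreover have "monotone_on (underS (list_order top_paths) q)
      (\<lambda>x y. x \<in> underS (list_order top_paths) y) (\<lambda>x y. x \<in> underS (omega_power s) y) v"
    using v_mono by (auto intro: monotone_onI)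
  ultimately show "\<exists>b\<in>Field (omega_power s).
      \<exists>h. h ` underS (list_order top_paths) q \<subseteq> underS (omega_power s) b \<and>
        monotone_on (underS (list_order top_paths) q)
          (\<lambda>x y. x \<in> underS (list_order top_paths) y) (\<lambda>x y. x \<in> underS (omega_power s) y) h"
    by blast
qed

theorem top_paths_ordIso_omega_power: "(list_order top_paths, omega_power s) \<in> ordIso"
  using top_paths_ordLeq_omega_power omega_power_ordLeq_top_paths ordIso_iff_ordLeq by blast

end

section \<open>The iterated function system\<close>

context exponent_enumeration
begin

text \<open>
  The retraction of a tree onto the subtree with the exponents below \<open>b\<close>. The larger blocks are
  collapsed to \<open>[]\<close>, the limit of all blocks; this costs only a factor \<open>2\<close> in distances, whatever
  \<open>b\<close> is.
\<close>

definition cut_below :: "'b \<Rightarrow> nat list \<Rightarrow> nat list" where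
  "cut_below b p = (case p of [] \<Rightarrow> [] | m # q \<Rightarrow> if e m \<in> underS s b then p else [])"

text \<open>
  The \<open>n\<close>-th copy of \<open>paths \<tau>\<close> in the attractor is retracted onto the \<open>n\<close>-th block of a single copy of
  \<open>paths \<tau>\<close>. The scales of the two blocks match because both carry the index \<open>n\<close>.
\<close>

definition collapse :: "nat list \<Rightarrow> nat list" where
  "collapse p = (case p of [] \<Rightarrow> [] | n # q \<Rightarrow> if e n \<in> underS s \<tau> then n # cut_below (e n) q else [])"

definition attractor :: "real \<Rightarrow> real set" where
  "attractor t = code t ` insert [] top_paths"

lemma code_cut_below_le:
  assumes "0 < t" "t \<le> 1/4"
  shows "code t (cut_below b p) \<le> code t p"
  using code_bounds[OF assms, of p] by (auto simp: cut_below_def split: list.split)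

lemma cut_below_lipschitz:
  assumes t: "0 < t" "t \<le> 1/4"
  shows "\<bar>code t (cut_below b p) - code t (cut_below b q)\<bar> \<le> 2 * \<bar>code t p - code t q\<bar>"
proof (rule code_map_lipschitz[OF t, of UNIV])
  fix n p q
  show "\<bar>code t (cut_below b (n # p)) - code t (cut_below b (n # q))\<bar>
      \<le> 2 * \<bar>code t (n # p) - code t (n # q)\<bar>"
    by (simp add: cut_below_def)
qed (use code_cut_below_le[OF t] in auto)

lemma code_Cons_diff:
  assumes "0 < t"
  shows "\<bar>code t (n # p) - code t (n # q)\<bar> = t ^ Suc n * t * \<bar>code t p - code t q\<bar>"
proof -
  have "code t (n # p) - code t (n # q) = t ^ Suc n * t * (code t p - code t q)"
    by (simp add: algebra_simps)
  then show ?thesis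
    using assms by (simp add: abs_mult)
qed

lemma collapse_lipschitz:
  assumes t: "0 < t" "t \<le> 1/4"
  shows "\<bar>code t (collapse p) - code t (collapse q)\<bar> \<le> 2 * \<bar>code t p - code t q\<bar>"
proof (rule code_map_lipschitz[OF t, of UNIV])
  fix p
  show "code t (collapse p) \<le> code t p"
  proof (cases p)
    case (Cons n q)
    have "t ^ Suc n * (1 + t * code t (cut_below (e n) q)) \<le> t ^ Suc n * (1 + t * code t q)"
      using t code_cut_below_le[OF t] by (intro mult_left_mono add_left_mono) auto
    then show ?thesis
      using Cons code_bounds[OF t, of p] by (auto simp: collapse_def)
  qed (simp add: collapse_def)
next
  fix n p q
  have "t ^ Suc n * t * \<bar>code t (cut_below (e n) p) - code t (cut_below (e n) q)\<bar>
      \<le> t ^ Suc n * t * (2 * \<bar>code t p - code t q\<bar>)"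
    using t by (intro mult_left_mono cut_below_lipschitz) auto
  then show "\<bar>code t (collapse (n # p)) - code t (collapse (n # q))\<bar>
      \<le> 2 * \<bar>code t (n # p) - code t (n # q)\<bar>"
    using t by (cases "e n \<in> underS s \<tau>") (simp_all add: collapse_def code_Cons_diff del: code.simps power_Suc)
qed auto

text \<open>
  A tail of a list in \<open>paths \<tau>\<close> with head \<open>n\<close> has only exponents below \<open>e n\<close> and is fixed by the
  retraction, so nothing of \<open>paths \<tau>\<close> is missed.
\<close>

lemma collapse_image: "collapse ` insert [] top_paths = paths \<tau>"
proof (intro subset_antisym subsetI)
  fix q assume "q \<in> collapse ` insert [] top_paths"
  then show "q \<in> paths \<tau>"
    by (auto simp: collapse_def cut_below_def top_paths_def paths_def split: list.splits)
next
  fix q assume q: "q \<in> paths \<tau>"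
  show "q \<in> collapse ` insert [] top_paths"
  proof (cases q)
    case Nil
    then show ?thesis
      by (intro image_eqI[of _ _ "[]"]) (auto simp: collapse_def)
  next
    case (Cons n p)
    then have n: "e n \<in> underS s \<tau>" and p: "descending (e n) p"
      using q by (auto simp: paths_def)
    have "cut_below (e n) p = p"
      using p by (cases p) (auto simp: cut_below_def)
    then have "collapse q = q"
      using Cons n by (simp add: collapse_def)
    moreover have "q \<in> top_paths"
      using Cons descending_mono[OF p top_greatest[OF e_Field]] by (simp add: top_paths_def paths_def)
    ultimately show ?thesis
      by (metis image_eqI insertI2)
  qed
qed

lemma compact_code_Cons:
  assumes t: "0 < t" "t \<le> 1/4" and A: "\<And>n. compact (code t ` A n)"
  shows "compact (code t ` insert [] {n # p |n p. p \<in> A n})"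
proof -
  let ?B = "\<lambda>n. (\<lambda>x. t ^ Suc n * (1 + t * x)) ` code t ` A n"
  have "code t ` insert [] {n # p |n p. p \<in> A n} = insert 0 (\<Union>n. ?B n)"
    by (force simp: image_iff)
  moreover have "compact (insert 0 (\<Union>n. ?B n))"
  proof (rule compact_shrinking_union)
    show "compact (?B n)" for n
      by (intro compact_continuous_image continuous_intros A)
    show "dist x 0 \<le> 2 * t ^ Suc n" if x: "x \<in> ?B n" for n x
    proof -
      obtain p where "x = code t (n # p)"
        using x by auto
      then show ?thesis
        using code_bounds[OF t, of "n # p"] code_Cons_bounds(2)[OF t, of n p] by (simp only: dist_real_def) simp
    qed
    have "(\<lambda>n. t ^ n) \<longlonglongrightarrow> 0"
      using t by (intro LIMSEQ_realpow_zero) auto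
    then have "(\<lambda>n. t ^ Suc n) \<longlonglongrightarrow> 0"
      by (rule LIMSEQ_Suc)
    from tendsto_mult_right_zero[OF this, of 2] show "(\<lambda>n. 2 * t ^ Suc n) \<longlonglongrightarrow> 0" .
  qed
  ultimately show ?thesis by simp
qed

lemma compact_code_paths:
  assumes t: "0 < t" "t \<le> 1/4"
  shows "b \<in> Field s \<Longrightarrow> compact (code t ` paths b)"
proof (induction b rule: wf_induct_rule[OF wf_s])
  case (1 b)
  define A where "A n = (if e n \<in> underS s b then paths (e n) else {})" for n
  have "compact (code t ` A n)" for n
    using "1.IH"[of "e n"] e_Field by (auto simp: A_def underS_def)
  moreover have "paths b = insert [] {n # p |n p. p \<in> A n}"
  proof (rule set_eqI)
    fix p show "p \<in> paths b \<longleftrightarrow> p \<in> insert [] {n # p |n p. p \<in> A n}"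
      by (cases p) (auto simp: paths_def A_def)
  qed
  ultimately show ?case
    using compact_code_Cons[OF t, of A] by simp
qed

lemma compact_attractor:
  assumes t: "0 < t" "t \<le> 1/4"
  shows "compact (attractor t)"
  using compact_code_Cons[OF t, of "\<lambda>_. paths \<tau>"] compact_code_paths[OF t top_Field]
  by (simp add: attractor_def top_paths_def)

text \<open>
  Multiplication by \<open>t\<close> raises the first entry of a list by one, so it produces all blocks but the first.
  The first block is a copy of \<open>paths \<tau>\<close> at the scale \<open>t\<^sup>2\<close>; the map \<open>p \<mapsto> 0 # collapse p\<close> covers it,
  and it is a contraction with constant \<open>2 * t\<^sup>2 \<le> t\<close>.
\<close>

lemma attractor_system:
  assumes t: "0 < t" "t \<le> 1/4"
  obtains \<phi> \<psi> :: "real \<Rightarrow> real" where "t-lipschitz_on {0..1} \<phi>" "\<phi> ` {0..1} \<subseteq> {0..1}"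
    "t-lipschitz_on {0..1} \<psi>" "\<psi> ` {0..1} \<subseteq> {0..1}" "invariant_compact {0..1} {\<phi>, \<psi>} (attractor t)"
proof -
  let ?B = "insert [] top_paths"
  define \<phi> where "\<phi> x = t * x" for x :: real
  define g where "g x = code t (0 # collapse (inv (code t) x))" for x
  have inj: "inj (code t)"
    using t by (rule code_inj)
  have g: "g (code t p) = code t (0 # collapse p)" for p
    using inj by (simp add: g_def)
  have in01: "code t p \<in> {0..1}" for p
    using code_bounds[OF t, of p] by auto
  have "t-lipschitz_on (attractor t) g"
  proof (rule lipschitz_onI)
    fix x y assume "x \<in> attractor t" "y \<in> attractor t"
    then obtain p q where pq: "x = code t p" "y = code t q"
      unfolding attractor_def by blast
    \<comment> \<open>Here \<open>t \<le> 1/2\<close> pays for the factor \<open>2\<close>.\<close>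
    have "\<bar>g x - g y\<bar> = t * t * \<bar>code t (collapse p) - code t (collapse q)\<bar>"
      unfolding pq g code_Cons_diff[OF t(1)] by simp
    also have "\<dots> \<le> t * t * (2 * \<bar>x - y\<bar>)"
      unfolding pq using t by (intro mult_left_mono collapse_lipschitz) auto
    also have "\<dots> = 2 * t * (t * \<bar>x - y\<bar>)"
      by simp
    also have "\<dots> \<le> 1 * (t * \<bar>x - y\<bar>)"
      using t by (intro mult_right_mono) auto
    finally show "dist (g x) (g y) \<le> t * dist x y"
      by (simp add: dist_real_def)
  qed (use t in simp)
  moreover have "attractor t \<noteq> {}" "g ` attractor t \<subseteq> {0..1}"
    using in01 by (auto simp: attractor_def g simp del: code.simps)
  ultimately obtain \<psi> where \<psi>: "t-lipschitz_on UNIV \<psi>" "\<And>x. x \<in> attractor t \<Longrightarrow> \<psi> x = g x"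
    "range \<psi> \<subseteq> {0..1}"
    using lipschitz_extension_unit_interval by metis
  have "t-lipschitz_on {0..1} \<phi>"
    using t by (intro lipschitz_onI) (auto simp: \<phi>_def dist_real_def abs_mult simp flip: right_diff_distrib)
  moreover have "\<phi> ` {0..1} \<subseteq> {0..1}"
    using t by (auto simp: \<phi>_def intro: mult_le_one)
  moreover have "t-lipschitz_on {0..1} \<psi>"
    using \<psi>(1) by (rule lipschitz_on_subset) simp
  moreover have "\<psi> ` {0..1} \<subseteq> {0..1}"
    using \<psi>(3) by auto
  moreover have "invariant_compact {0..1} {\<phi>, \<psi>} (attractor t)"
    unfolding invariant_compact_def
  proof (intro conjI)
    show "attractor t \<subseteq> {0..1}"
      using in01 by (auto simp: attractor_def simp del: code.simps)
    show "attractor t \<noteq> {}"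
      by (simp add: attractor_def)
    show "compact (attractor t)"
      using t by (rule compact_attractor)
    have "\<phi> (code t (n # p)) = code t (Suc n # p)" "\<phi> (code t []) = code t []" for n p
      by (simp_all add: \<phi>_def)
    then have \<phi>_image: "\<phi> ` attractor t = code t ` ({[]} \<union> {Suc n # p |n p. p \<in> paths \<tau>})"
      unfolding attractor_def top_paths_def by (force simp: image_iff simp del: code.simps)
    have \<psi>_image: "\<psi> ` attractor t = code t ` {0 # p |p. p \<in> paths \<tau>}"
    proof -
      have "\<psi> ` attractor t = (\<lambda>p. code t (0 # p)) ` collapse ` ?B"
        using \<psi>(2) g by (simp add: attractor_def image_image del: code.simps)
      then show ?thesis
        unfolding collapse_image by (auto simp: image_image Setcompr_eq_image)
    qed
    have B: "?B = {[]} \<union> {Suc n # p |n p. p \<in> paths \<tau>} \<union> {0 # p |p. p \<in> paths \<tau>}"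
    proof (rule set_eqI)
      fix p
      show "p \<in> ?B \<longleftrightarrow> p \<in> {[]} \<union> {Suc n # p |n p. p \<in> paths \<tau>} \<union> {0 # p |p. p \<in> paths \<tau>}"
      proof (cases p)
        case (Cons n q)
        then show ?thesis
          by (cases n) (simp_all add: top_paths_def)
      qed simp
    qed
    have "attractor t = \<phi> ` attractor t \<union> \<psi> ` attractor t"
      unfolding \<phi>_image \<psi>_image unfolding attractor_def B image_Un ..
    then show "attractor t = (\<Union>f\<in>{\<phi>, \<psi>}. f ` attractor t)"
      unfolding UN_insert UN_empty Un_empty_right .
  qed
  ultimately show thesis
    by (rule that)
qed

end

section \<open>The ordinals as attractors\<close>

lemma Field_ord_succ: "Field (ord_succ r) = insert None (Some ` Field r)"
  by (auto simp: ord_succ_def Field_def)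

lemma ord_succ_iff [simp]:
  "(Some a, Some b) \<in> ord_succ r \<longleftrightarrow> (a, b) \<in> r"
  "(Some a, None) \<in> ord_succ r \<longleftrightarrow> a \<in> Field r"
  "(None, Some b) \<notin> ord_succ r"
  "(None, None) \<in> ord_succ r"
  by (auto simp: ord_succ_def)

lemma Linear_order_ord_succ:
  assumes "Linear_order r"
  shows "Linear_order (ord_succ r)"
proof -
  have r: "Refl r" "trans r" "antisym r" "Total r"
    using assms by (auto simp: order_on_defs)
  have "Refl (ord_succ r)"
    using r(1) unfolding refl_on_def Field_ord_succ by (auto simp: ord_succ_def)
  moreover have "trans (ord_succ r)"
    unfolding trans_def
  proof (intro allI impI)
    fix x y z assume "(x, y) \<in> ord_succ r" "(y, z) \<in> ord_succ r"
    then show "(x, z) \<in> ord_succ r"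
      by (cases x; cases y; cases z; simp; metis transD[OF r(2)] FieldI1)
  qed
  moreover have "antisym (ord_succ r)"
    unfolding antisym_def
  proof (intro allI impI)
    fix x y assume "(x, y) \<in> ord_succ r" "(y, x) \<in> ord_succ r"
    then show "x = y"
      using antisymD[OF r(3)] by (cases x; cases y) simp_all
  qed
  moreover have "Total (ord_succ r)"
    using r(4) unfolding total_on_def Field_ord_succ by (auto simp: ord_succ_def)
  ultimately show ?thesis
    by (auto simp: order_on_defs refl_on_def Field_def)
qed

lemma Well_order_ord_succ:
  assumes "Well_order r"
  shows "Well_order (ord_succ r)"
proof -
  have r: "Linear_order r" "wf (r - Id)"
    using assms by (auto simp: well_order_on_def)
  have "wf (ord_succ r - Id)"
  proof (rule wfI_min)
    fix x and Q :: "'a option set" assume x: "x \<in> Q"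
    show "\<exists>z\<in>Q. \<forall>y. (y, z) \<in> ord_succ r - Id \<longrightarrow> y \<notin> Q"
    proof (cases "Q \<subseteq> {None}")
      case True
      then have "Q = {None}" using x by auto
      then show ?thesis by auto
    next
      case False
      then obtain a where "a \<in> {a. Some a \<in> Q}" by (metis mem_Collect_eq not_Some_eq singletonI subsetI)
      then obtain m where m: "m \<in> {a. Some a \<in> Q}" "\<And>y. (y, m) \<in> r - Id \<Longrightarrow> y \<notin> {a. Some a \<in> Q}"
        by (rule wfE_min[OF r(2)]) (rule that)
      have "y \<notin> Q" if "(y, Some m) \<in> ord_succ r - Id" for y
        using that m(2) by (auto simp: ord_succ_def)
      then show ?thesis using m(1) by blast
    qed
  qed
  then show ?thesis
    using Linear_order_ord_succ[OF r(1)] by (simp add: well_order_on_def)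
qed

context exponent_enumeration
begin

lemma attractor_homeomorphic:
  assumes t: "0 < t" "t \<le> 1/4"
  shows "ord_topology (ord_succ (omega_power s)) homeomorphic_space top_of_set (attractor t)"
proof -
  let ?B = "insert [] top_paths" and ?r = "ord_succ (omega_power s)"
  obtain F where F: "iso (list_order top_paths) (omega_power s) F"
    using top_paths_ordIso_omega_power by (auto simp: ordIso_def)
  have FB: "bij_betw F top_paths (Field (omega_power s))"
    using F by (simp add: iso_def Field_list_order)
  have nil: "[] \<notin> top_paths"
    by (simp add: top_paths_def)
  \<comment> \<open>The empty list has code \<open>0\<close>, the least value; reversing the order makes it the endpoint.\<close>
  define h where "h p = (if p = [] then None else Some (F p))" for p
  have hF: "h p = Some (F p)" if "p \<in> top_paths" for p
    using that nil by (auto simp: h_def)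
  have "h ` top_paths = Some ` F ` top_paths"
    unfolding image_image using hF by (rule image_cong[OF HOL.refl])
  moreover have "h [] = None"
    by (simp add: h_def)
  ultimately have "h ` ?B = Field ?r"
    using FB unfolding Field_ord_succ by (simp add: bij_betw_def)
  moreover have "inj_on h ?B"
    using FB nil by (auto simp: h_def bij_betw_def inj_on_def)
  ultimately have h: "bij_betw h ?B (Field ?r)"
    by (simp add: bij_betw_def)
  have inj: "inj (code t)"
    using t by (rule code_inj)
  define g where "g x = h (inv (code t) x)" for x
  have g: "g (code t p) = h p" for p
    using inj by (simp add: g_def)
  have "g ` attractor t = Field ?r"
    using h by (simp add: attractor_def image_image g bij_betw_def del: code.simps)
  moreover have "inj_on g (attractor t)"
  proof (rule inj_onI)
    fix x y assume xy: "x \<in> attractor t" "y \<in> attractor t" "g x = g y"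
    then obtain p q where "p \<in> ?B" "q \<in> ?B" "x = code t p" "y = code t q"
      unfolding attractor_def by blast
    then show "x = y"
      using xy(3) g inj_onD[of h ?B p q] h by (auto simp: bij_betw_def simp del: code.simps)
  qed
  ultimately have gK: "bij_betw g (attractor t) (Field ?r)"
    by (simp add: bij_betw_def)
  show ?thesis
  proof (rule ord_topology_homeomorphic_compact[OF _ compact_attractor[OF t] gK])
    show "Linear_order ?r"
      by (intro Linear_order_ord_succ Linear_order_omega_power Linear_order)
    fix x y assume xy: "x \<in> attractor t" "y \<in> attractor t" "y < x"
    then obtain p q where pq: "p \<in> ?B" "q \<in> ?B" "x = code t p" "y = code t q"
      unfolding attractor_def by blast
    then have less: "before p q"
      using xy(3) code_strict_antimono_iff[OF t] by simp
    then have p: "p \<in> top_paths"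
      using pq(1) by auto
    have Fp: "F p \<in> Field (omega_power s)"
      using FB p by (auto simp: bij_betw_def)
    have "h p \<in> underS ?r (h q)"
    proof (cases "q = []")
      case True
      then show ?thesis
        using hF[OF p] Fp by (simp add: h_def underS_def ord_succ_def)
    next
      case False
      then have q: "q \<in> top_paths" using pq(2) by simp
      have "(F p, F q) \<in> omega_power s"
        using p q less by (intro iso_forward[OF _ F]) (simp add: list_order_def)
      moreover have "F p \<noteq> F q"
        using FB p q less before_irrefl by (metis bij_betw_imp_inj_on inj_onD)
      ultimately show ?thesis
        using hF[OF p] hF[OF q] by (simp add: underS_def ord_succ_def)
    qed
    then show "g x \<in> underS ?r (g y)"
      using pq g by simp
  qed
qed

end

lemma enumeration_with_infinite_fibres:
  assumes "countable A" "A \<noteq> {}"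
  obtains e :: "nat \<Rightarrow> 'a" where "\<And>n. e n \<in> A" "\<And>a. a \<in> A \<Longrightarrow> infinite {n. e n = a}"
proof -
  define e where "e n = from_nat_into A (fst (prod_decode n))" for n
  have "e n \<in> A" for n
    using assms(2) by (simp add: e_def from_nat_into)
  moreover have "infinite {n. e n = a}" if a: "a \<in> A" for a
  proof -
    obtain i where i: "from_nat_into A i = a"
      using from_nat_into_surj[OF assms(1) a] by blast
    have "inj (\<lambda>k. prod_encode (i, k))"
      by (auto simp: inj_def)
    then have "infinite (range (\<lambda>k. prod_encode (i, k)))"
      using infinite_UNIV_nat finite_imageD by blast
    moreover have "range (\<lambda>k. prod_encode (i, k)) \<subseteq> {n. e n = a}"
      using i by (auto simp: e_def)
    ultimately show ?thesis
      using infinite_super by blast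
  qed
  ultimately show thesis
    by (rule that)
qed

theorem theorem4:
  fixes \<epsilon> :: real and \<delta> :: "'a rel"
  assumes "\<epsilon> > 0"
    and "Well_order \<delta>" and "countable (Field \<delta>)"
  shows "\<exists>(\<phi> :: real \<Rightarrow> real) (\<psi> :: real \<Rightarrow> real) K.
           contraction_in {0..1} \<phi> \<and> contraction_in {0..1} \<psi> \<and>
           is_attractor {0..1} {\<phi>, \<psi>} K \<and>
           ord_topology (ord_succ (omega_power (ord_succ \<delta>))) homeomorphic_space top_of_set K \<and>
           max (Lip {0..1} \<phi>) (Lip {0..1} \<psi>) < \<epsilon>"
proof -
  have "countable (Field (ord_succ \<delta>))" "Field (ord_succ \<delta>) \<noteq> {}"
    using assms(3) by (auto simp: Field_ord_succ)
  then obtain e :: "nat \<Rightarrow> 'a option" where e: "\<And>n. e n \<in> Field (ord_succ \<delta>)"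
    "\<And>b. b \<in> Field (ord_succ \<delta>) \<Longrightarrow> infinite {n. e n = b}"
    by (rule enumeration_with_infinite_fibres) (rule that)
  interpret exponent_enumeration "ord_succ \<delta>" e None
  proof
    show "Well_order (ord_succ \<delta>)"
      using assms(2) by (rule Well_order_ord_succ)
    show "(b, None) \<in> ord_succ \<delta>" if "b \<in> Field (ord_succ \<delta>)" for b
      using that unfolding Field_ord_succ by (auto simp: ord_succ_def)
  qed (use e in \<open>auto simp: Field_ord_succ\<close>)
  define t where "t = min (1/4) (\<epsilon> / 2)"
  have t: "0 < t" "t \<le> 1/4" "t < \<epsilon>" "t < 1"
    using assms(1) by (auto simp: t_def)
  obtain \<phi> \<psi> where \<phi>: "t-lipschitz_on {0..1} \<phi>" "\<phi> ` {0..1} \<subseteq> {0..1}"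
    and \<psi>: "t-lipschitz_on {0..1} \<psi>" "\<psi> ` {0..1} \<subseteq> {0..1}"
    and inv: "invariant_compact {0..1} {\<phi>, \<psi>} (attractor t)"
    using attractor_system[OF t(1,2)] by metis
  have "contraction_in {0..1} \<phi>" "contraction_in {0..1} \<psi>"
    unfolding contraction_in_def using \<phi> \<psi> t by blast+
  moreover have "is_attractor {0..1} {\<phi>, \<psi>} (attractor t)"
    using \<phi>(1) \<psi>(1) by (intro is_attractorI[OF _ t(4) inv]) auto
  moreover have "max (Lip {0..1} \<phi>) (Lip {0..1} \<psi>) < \<epsilon>"
    using Lip_le[OF \<phi>(1)] Lip_le[OF \<psi>(1)] t(3) by simp
  ultimately show ?thesis
    using attractor_homeomorphic[OF t(1,2)] by blast
qed

end
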